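(* Let $\mathcal{V}_c$ be the permutation model defined in the context and let $\mathfrak{m}$ denote the cardinality of its set of atoms. Then $\mathcal{V}_c\models\operatorname{seq}^{1\text{-}1}(\mathfrak{m})<2^{\mathfrak{m}} <\operatorname{seq}(\mathfrak{m})$.
   Context: Permutation models: work in a model of ZFA + AC (set theory with atoms) with set of atoms $A$, and let $\mathcal{G}$ be a group of permutations of $A$; each $\pi\in\mathcal{G}$ extends uniquely to an $\in$-automorphism of the universe, also written $\pi$. For $E\subseteq A$ let $\operatorname{fix}_{\mathcal{G}}(E)=\{\pi\in\mathcal{G}:\pi a=a\text{ for all }a\in E\}$. An object $x$ is symmetric if $\{\pi\in\mathcal{G}:\pi x=x\}$ belongs to the normal filter on $\mathcal{G}$ generated by $\{\operatorname{fix}_{\mathcal{G}}(E):E\subseteq A\text{ finite}\}$. The permutation model is the class of all hereditarily symmetric objects; it is a transitive model of ZFA. The model $\mathcal{V}_c$. Let $L$ be the signature consisting of a binary relation symbol $<$ and, for each $n\in\mathbb{N}=\{0,1,2,\dots\}$, an $(n+1)$-ary relation symbol $R_n$. Let $T_0$ be the theory stating that $<$ is a (strict) linear order and that for each $n\in\mathbb{N}$, $R_n(z_0,\ldots,z_n)\rightarrow\bigwedge_{l\ne k}(z_l\ne z_k)$. Let $K$ be the class of finitely generated (i.e. finite) structures of $T_0$. $K$ has the amalgamation property, and there is a unique (up to isomorphism) structure $M$ of $T_0$ such that $\operatorname{dom}(M)$ has cardinality $\aleph_0$, every $N\in K$ embeds in $M$, and every isomorphism between finitely generated substructures of $M$ extends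 to an automorphism of $M$. The set of atoms of $\mathcal{V}_c$ is $A=\operatorname{dom}(M)$, $\mathcal{G}$ is the group of all automorphisms of $M$, and $\mathcal{V}_c$ is the permutation model determined by $A$, $\mathcal{G}$ and the normal filter on $\mathcal{G}$ generated by $\{\operatorname{fix}_{\mathcal{G}}(E):E\subseteq A\text{ finite}\}$. Cardinal relations in $\mathcal{V}_c$ are computed using functions belonging to $\mathcal{V}_c$: $\mathfrak{p}\le\mathfrak{q}$ iff there is in the model an injection from a set of cardinality $\mathfrak{p}$ into one of cardinality $\mathfrak{q}$; $\mathfrak{p}<\mathfrak{q}$ means $\mathfrak{p}\le\mathfrak{q}$ and $\mathfrak{p}\ne\mathfrak{q}$. For a set $m$ of cardinality $\mathfrak{m}$ (all computed in the model): $\operatorname{seq}^{1\text{-}1}(\mathfrak{m})$ is the cardinality of the set of finite sequences of elements of $m$ without repetition; $\operatorname{seq}(\mathfrak{m})$ that of the set of all finite sequences of elements of $m$; $2^{\mathfrak{m}}$ that of the power set of $m$. *)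

theory Defs
  imports "HOL-Algebra.Bij" "HOL-Algebra.Coset" "HOL-Library.Countable_Set"
begin

section \<open>Structures for the signature of the model\<close>

text \<open>One binary relation \<open><\<close> and, for each \<open>n\<close>, one \<open>(n+1)\<close>-ary relation \<open>R\<^sub>n\<close>, whose
  argument tuples are lists of length \<open>n + 1\<close>.\<close>

record 'a lstruct =
  univ :: "'a set"
  less_rel :: "'a rel"
  R_rel :: "nat \<Rightarrow> 'a list set"

definition is_lstruct :: "'a lstruct \<Rightarrow> bool" where
  "is_lstruct N \<longleftrightarrow>
     less_rel N \<subseteq> univ N \<times> univ N \<and>
     (\<forall>n. R_rel N n \<subseteq> {zs. length zs = Suc n \<and> set zs \<subseteq> univ N})"

definition models_T0 :: "'a lstruct \<Rightarrow> bool" where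
  "models_T0 N \<longleftrightarrow>
     is_lstruct N \<and>
     strict_linear_order_on (univ N) (less_rel N) \<and>
     (\<forall>n. \<forall>zs \<in> R_rel N n. distinct zs)"

definition lembedding :: "('a \<Rightarrow> 'b) \<Rightarrow> 'a lstruct \<Rightarrow> 'b lstruct \<Rightarrow> bool" where
  "lembedding f N M \<longleftrightarrow>
     inj_on f (univ N) \<and> f ` univ N \<subseteq> univ M \<and>
     (\<forall>x \<in> univ N. \<forall>y \<in> univ N. (x, y) \<in> less_rel N \<longleftrightarrow> (f x, f y) \<in> less_rel M) \<and>
     (\<forall>n zs. length zs = Suc n \<and> set zs \<subseteq> univ N \<longrightarrow>
        (zs \<in> R_rel N n \<longleftrightarrow> map f zs \<in> R_rel M n))"

definition lisomorphism :: "('a \<Rightarrow> 'b) \<Rightarrow> 'a lstruct \<Rightarrow> 'b lstruct \<Rightarrow> bool" where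
  "lisomorphism f N M \<longleftrightarrow> lembedding f N M \<and> f ` univ N = univ M"

definition substruct :: "'a lstruct \<Rightarrow> 'a set \<Rightarrow> 'a lstruct" where
  "substruct M S =
     \<lparr>univ = S, less_rel = less_rel M \<inter> S \<times> S, R_rel = (\<lambda>n. {zs \<in> R_rel M n. set zs \<subseteq> S})\<rparr>"

text \<open>The signature is relational, so the finitely generated structures are the finite ones.
  The structures \<open>N\<close> below live on the same type as \<open>M\<close>; this is no restriction, since that type
  is infinite and hence carries an isomorphic copy of every finite structure.\<close>

definition is_generic :: "'a lstruct \<Rightarrow> bool" where
  "is_generic M \<longleftrightarrow>
     models_T0 M \<and>
     countable (univ M) \<and> infinite (univ M) \<and>
     (\<forall>N :: 'a lstruct. models_T0 N \<and> finite (univ N) \<longrightarrow> (\<exists>f. lembedding f N M)) \<and>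
     (\<forall>S T f. finite S \<and> S \<subseteq> univ M \<and> finite T \<and> T \<subseteq> univ M \<and>
        lisomorphism f (substruct M S) (substruct M T) \<longrightarrow>
        (\<exists>g. lisomorphism g M M \<and> (\<forall>x \<in> S. g x = f x)))"

text \<open>As in \<^const>\<open>BijGroup\<close>, permutations are \<^const>\<open>undefined\<close> outside of the permuted set.\<close>

definition aut_group :: "'a lstruct \<Rightarrow> ('a \<Rightarrow> 'a) monoid" where
  "aut_group M =
     (BijGroup (univ M))\<lparr>carrier := {g \<in> Bij (univ M). lisomorphism g M M}\<rparr>"


section \<open>Normal filters of subgroups\<close>

definition normal_filter :: "('g, 'b) monoid_scheme \<Rightarrow> 'g set set \<Rightarrow> bool" where
  "normal_filter G F \<longleftrightarrow>
     (\<forall>H \<in> F. subgroup H G) \<and>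
     carrier G \<in> F \<and>
     (\<forall>H \<in> F. \<forall>K. subgroup K G \<and> H \<subseteq> K \<longrightarrow> K \<in> F) \<and>
     (\<forall>H \<in> F. \<forall>K \<in> F. H \<inter> K \<in> F) \<and>
     (\<forall>g \<in> carrier G. \<forall>H \<in> F. (g <#\<^bsub>G\<^esub> H) #>\<^bsub>G\<^esub> (inv\<^bsub>G\<^esub> g) \<in> F)"

definition generated_normal_filter :: "('g, 'b) monoid_scheme \<Rightarrow> 'g set set \<Rightarrow> 'g set set" where
  "generated_normal_filter G B = \<Inter>{F. normal_filter G F \<and> B \<subseteq> F}"

definition fixgroup :: "('a \<Rightarrow> 'a) monoid \<Rightarrow> 'a set \<Rightarrow> ('a \<Rightarrow> 'a) set" where
  "fixgroup G E = {\<pi> \<in> carrier G. \<forall>a \<in> E. \<pi> a = a}"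


section \<open>The language of set theory with atoms\<close>

text \<open>A type \<open>'v\<close> with a membership relation and a predicate singling out the atoms.
  Each notion below is relativised to a class \<open>N\<close> of objects: all quantifiers range over \<open>N\<close>
  only, so that a notion for \<open>N\<close> expresses its validity in the structure \<open>(N, \<epsilon>, atom)\<close>.\<close>

locale eps_structure =
  fixes mem :: "'v \<Rightarrow> 'v \<Rightarrow> bool"  (infix "\<epsilon>" 50)
    and atom :: "'v \<Rightarrow> bool"
begin

definition is_empty :: "'v set \<Rightarrow> 'v \<Rightarrow> bool" where
  "is_empty N e \<longleftrightarrow> \<not> atom e \<and> (\<forall>x \<in> N. \<not> x \<epsilon> e)"

definition is_succ :: "'v set \<Rightarrow> 'v \<Rightarrow> 'v \<Rightarrow> bool" where
  "is_succ N y x \<longleftrightarrow> \<not> atom y \<and> (\<forall>z \<in> N. z \<epsilon> y \<longleftrightarrow> z \<epsilon> x \<or> z = x)"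

definition is_inductive :: "'v set \<Rightarrow> 'v \<Rightarrow> bool" where
  "is_inductive N I \<longleftrightarrow>
     (\<exists>e \<in> N. is_empty N e \<and> e \<epsilon> I) \<and>
     (\<forall>x \<in> N. x \<epsilon> I \<longrightarrow> (\<exists>y \<in> N. is_succ N y x \<and> y \<epsilon> I))"

definition is_natural :: "'v set \<Rightarrow> 'v \<Rightarrow> bool" where
  "is_natural N n \<longleftrightarrow> (\<forall>I \<in> N. is_inductive N I \<longrightarrow> n \<epsilon> I)"

definition is_upair :: "'v set \<Rightarrow> 'v \<Rightarrow> 'v \<Rightarrow> 'v \<Rightarrow> bool" where
  "is_upair N z x y \<longleftrightarrow> \<not> atom z \<and> (\<forall>w \<in> N. w \<epsilon> z \<longleftrightarrow> w = x \<or> w = y)"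

definition is_opair :: "'v set \<Rightarrow> 'v \<Rightarrow> 'v \<Rightarrow> 'v \<Rightarrow> bool" where
  "is_opair N p x y \<longleftrightarrow>
     (\<exists>a \<in> N. \<exists>b \<in> N. is_upair N a x x \<and> is_upair N b x y \<and> is_upair N p a b)"

definition maps_to :: "'v set \<Rightarrow> 'v \<Rightarrow> 'v \<Rightarrow> 'v \<Rightarrow> bool" where
  "maps_to N f x y \<longleftrightarrow> (\<exists>p \<in> N. is_opair N p x y \<and> p \<epsilon> f)"

definition is_function :: "'v set \<Rightarrow> 'v \<Rightarrow> 'v \<Rightarrow> 'v \<Rightarrow> bool" where
  "is_function N f X Y \<longleftrightarrow>
     \<not> atom f \<and>
     (\<forall>p \<in> N. p \<epsilon> f \<longrightarrow> (\<exists>x \<in> N. \<exists>y \<in> N. x \<epsilon> X \<and> y \<epsilon> Y \<and> is_opair N p x y)) \<and>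
     (\<forall>x \<in> N. x \<epsilon> X \<longrightarrow> (\<exists>!y. y \<in> N \<and> maps_to N f x y))"

definition is_injection :: "'v set \<Rightarrow> 'v \<Rightarrow> 'v \<Rightarrow> 'v \<Rightarrow> bool" where
  "is_injection N f X Y \<longleftrightarrow>
     is_function N f X Y \<and>
     (\<forall>x \<in> N. \<forall>x' \<in> N. \<forall>y \<in> N. maps_to N f x y \<and> maps_to N f x' y \<longrightarrow> x = x')"

definition is_bijection :: "'v set \<Rightarrow> 'v \<Rightarrow> 'v \<Rightarrow> 'v \<Rightarrow> bool" where
  "is_bijection N f X Y \<longleftrightarrow>
     is_injection N f X Y \<and> (\<forall>y \<in> N. y \<epsilon> Y \<longrightarrow> (\<exists>x \<in> N. maps_to N f x y))"

text \<open>Comparison of the cardinalities of the sets \<open>X\<close> and \<open>Y\<close>.\<close>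

definition card_le :: "'v set \<Rightarrow> 'v \<Rightarrow> 'v \<Rightarrow> bool" where
  "card_le N X Y \<longleftrightarrow> (\<exists>f \<in> N. is_injection N f X Y)"

definition card_eq :: "'v set \<Rightarrow> 'v \<Rightarrow> 'v \<Rightarrow> bool" where
  "card_eq N X Y \<longleftrightarrow> (\<exists>f \<in> N. is_bijection N f X Y)"

definition card_less :: "'v set \<Rightarrow> 'v \<Rightarrow> 'v \<Rightarrow> bool" where
  "card_less N X Y \<longleftrightarrow> card_le N X Y \<and> \<not> card_eq N X Y"

definition is_set_of_atoms :: "'v set \<Rightarrow> 'v \<Rightarrow> bool" where
  "is_set_of_atoms N A \<longleftrightarrow> \<not> atom A \<and> (\<forall>x \<in> N. x \<epsilon> A \<longleftrightarrow> atom x)"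

definition is_powerset :: "'v set \<Rightarrow> 'v \<Rightarrow> 'v \<Rightarrow> bool" where
  "is_powerset N P X \<longleftrightarrow>
     \<not> atom P \<and> (\<forall>y \<in> N. y \<epsilon> P \<longleftrightarrow> \<not> atom y \<and> (\<forall>z \<in> N. z \<epsilon> y \<longrightarrow> z \<epsilon> X))"

definition is_seq_set :: "'v set \<Rightarrow> 'v \<Rightarrow> 'v \<Rightarrow> bool" where
  "is_seq_set N S X \<longleftrightarrow>
     \<not> atom S \<and>
     (\<forall>s \<in> N. s \<epsilon> S \<longleftrightarrow> (\<exists>n \<in> N. is_natural N n \<and> is_function N s n X))"

definition is_injseq_set :: "'v set \<Rightarrow> 'v \<Rightarrow> 'v \<Rightarrow> bool" where
  "is_injseq_set N S X \<longleftrightarrow>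
     \<not> atom S \<and>
     (\<forall>s \<in> N. s \<epsilon> S \<longleftrightarrow> (\<exists>n \<in> N. is_natural N n \<and> is_injection N s n X))"

end


section \<open>ZFA with choice, and permutation models\<close>

text \<open>The type \<open>'v\<close> is the universe. Separation and replacement are stated for arbitrary
  predicates and functions on the universe.\<close>

locale ZFA = eps_structure +
  assumes atoms_have_no_elements: "atom a \<Longrightarrow> \<not> x \<epsilon> a"
    and extensionality: "\<lbrakk>\<not> atom x; \<not> atom y; \<And>z. z \<epsilon> x \<longleftrightarrow> z \<epsilon> y\<rbrakk> \<Longrightarrow> x = y"
    and foundation: "y \<epsilon> x \<Longrightarrow> \<exists>z. z \<epsilon> x \<and> \<not> (\<exists>w. w \<epsilon> z \<and> w \<epsilon> x)"
    and atoms_set: "\<exists>A. is_set_of_atoms UNIV A"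
    and pairing: "\<exists>z. is_upair UNIV z x y"
    and union: "\<exists>u. \<not> atom u \<and> (\<forall>z. z \<epsilon> u \<longleftrightarrow> (\<exists>y. y \<epsilon> x \<and> z \<epsilon> y))"
    and powerset: "\<exists>p. is_powerset UNIV p x"
    and infinity: "\<exists>I. is_inductive UNIV I"
    and separation: "\<exists>y. \<not> atom y \<and> (\<forall>z. z \<epsilon> y \<longleftrightarrow> z \<epsilon> x \<and> \<phi> z)"
    and replacement: "\<exists>y. \<not> atom y \<and> (\<forall>z. z \<epsilon> y \<longleftrightarrow> (\<exists>w. w \<epsilon> x \<and> z = \<Phi> w))"
    and choice: "\<lbrakk>\<And>y. y \<epsilon> x \<Longrightarrow> \<exists>z. z \<epsilon> y;
        \<And>y y' z. \<lbrakk>y \<epsilon> x; y' \<epsilon> x; z \<epsilon> y; z \<epsilon> y'\<rbrakk> \<Longrightarrow> y = y'\<rbrakk>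
      \<Longrightarrow> \<exists>c. \<forall>y. y \<epsilon> x \<longrightarrow> (\<exists>!z. z \<epsilon> y \<and> z \<epsilon> c)"

context eps_structure
begin

definition eps_automorphism :: "('v \<Rightarrow> 'v) \<Rightarrow> bool" where
  "eps_automorphism \<phi> \<longleftrightarrow>
     bij \<phi> \<and> (\<forall>x. atom (\<phi> x) \<longleftrightarrow> atom x) \<and> (\<forall>x y. \<phi> x \<epsilon> \<phi> y \<longleftrightarrow> x \<epsilon> y)"

text \<open>In \<open>ZFA\<close>, every permutation of the atoms extends uniquely to an \<open>\<epsilon>\<close>-automorphism.\<close>

definition lift :: "('v \<Rightarrow> 'v) \<Rightarrow> 'v \<Rightarrow> 'v" where
  "lift \<pi> = (THE \<phi>. eps_automorphism \<phi> \<and> (\<forall>a. atom a \<longrightarrow> \<phi> a = \<pi> a))"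

definition symmetric :: "('v \<Rightarrow> 'v) monoid \<Rightarrow> ('v \<Rightarrow> 'v) set set \<Rightarrow> 'v \<Rightarrow> bool" where
  "symmetric G F x \<longleftrightarrow> {\<pi> \<in> carrier G. lift \<pi> x = x} \<in> F"

text \<open>The objects \<open>y\<close> with \<open>mem\<^sup>*\<^sup>* y x\<close> are \<open>x\<close> and the elements of its transitive closure.\<close>

definition permutation_model :: "('v \<Rightarrow> 'v) monoid \<Rightarrow> ('v \<Rightarrow> 'v) set set \<Rightarrow> 'v set" where
  "permutation_model G F = {x. \<forall>y. mem\<^sup>*\<^sup>* y x \<longrightarrow> symmetric G F y}"

definition V_c :: "'v lstruct \<Rightarrow> 'v set" where
  "V_c M = permutation_model (aut_group M)
     (generated_normal_filter (aut_group M)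
       {fixgroup (aut_group M) E | E. finite E \<and> E \<subseteq> univ M})"

end

end

theory Submission
  imports Defs
begin

text \<open>
  Let \<open>A\<close> be the set of atoms and \<open>G\<close> the automorphism group of the generic structure.
  A set or function belongs to the model iff its elements do and it is invariant under the
  automorphisms that fix some finite \<open>E \<subseteq> A\<close> pointwise; such an \<open>E\<close> is a support. The
  model is transitive and contains all finite sequences of atoms, and its subsets of \<open>A\<close> are
  the \<^emph>\<open>symmetric\<close> ones, those with a finite support. So the two strict inequalities are
  statements about maps between lists of atoms and symmetric sets of atoms that commute with the
  automorphisms fixing some finite \<open>E\<close>. The proof has four parts.

  \<^item> From sequences without repetition to sets: \<open>us \<mapsto> {x. R\<^sub>n(us, x)}\<close>, where \<open>n\<close> is
    the length of \<open>us\<close>, commutes with all of \<open>G\<close>. By genericity any two of these sets differ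
    (\<open>fibre_inject\<close>), and more: for finite \<open>E\<close> every set \<open>T\<close> of sequences without
    repetition over \<open>E\<close> has some \<open>x\<close> outside of \<open>E\<close> with \<open>R\<^sub>n(us, x)\<close> exactly
    for the \<open>us \<in> T\<close>.
  \<^item> This map cannot be replaced by a bijection: if \<open>E\<close> supports a bijection, the sets
    supported by \<open>E\<close> come from the sequences over \<open>E\<close>. The points \<open>x\<close> just mentioned
    give as many such sets as there are sets \<open>T\<close>, contradicting Cantor's theorem
    (\<open>no_bijection_inj_lists\<close>).
  \<^item> From sets to sequences: every symmetric set \<open>D\<close> has a least support
    (\<open>supports_Int\<close>), which the linear order turns into a list. The set is
    determined by this list and its orbit under \<open>G\<close>, because an automorphism that maps a
    finite set to itself fixes its points. As there are only countably many symmetric sets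
    (\<open>countable_Sym\<close>), the orbit is given by a natural number, which two fixed atoms write into
    the sequence (\<open>code_set_inject\<close>).
  \<^item> There is no bijection: every finite \<open>E\<close> supports only finitely many sets, since
    there are finitely many types over \<open>E\<close> (\<open>finite_supported\<close>), but if \<open>E\<close> is not
    empty, it supports infinitely many sequences (\<open>no_bijection_lists\<close>).

  The model-theoretic input is \<open>realise_type\<close> and \<open>same_type_conjugate\<close>: over a finite
  set all one-point types are realised, and points of the same type are conjugate. The set-theoretic
  input is the extension of permutations to the universe by recursion on membership, the description
  of the filter by finite supports (\<open>mem_symmetry_filter\<close>), and the absoluteness of pairs,
  functions and natural numbers for the model.
\<close>


section \<open>Lists and subgroups\<close>

text \<open>Every list without repetition that contains \<open>z\<close> has the form \<open>ins z us k\<close> with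
  \<open>z\<close> not in \<open>us\<close>, in only one way. So the relations between \<open>z\<close> and a set \<open>U\<close>
  are described by pairs \<open>(us, k)\<close> that do not mention \<open>z\<close>.\<close>

definition ins :: "'a \<Rightarrow> 'a list \<Rightarrow> nat \<Rightarrow> 'a list" where
  "ins z us k = take k us @ z # drop k us"

lemma length_ins [simp]: "length (ins z us k) = Suc (length us)"
  by (simp add: ins_def)

lemma set_ins [simp]: "set (ins z us k) = insert z (set us)"
  unfolding ins_def by (metis Un_insert_right append_take_drop_id list.simps(15) set_append)

lemma map_ins: "map g (ins z us k) = ins (g z) (map g us) k"
  by (simp add: ins_def take_map drop_map)

lemma distinct_ins: "distinct (ins z us k) \<longleftrightarrow> distinct us \<and> z \<notin> set us"
proof -
  have "distinct (xs @ z # ys) \<longleftrightarrow> distinct (xs @ ys) \<and> z \<notin> set (xs @ ys)" for xs ys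
    by auto
  from this[of "take k us" "drop k us"] show ?thesis
    by (simp only: ins_def append_take_drop_id)
qed

lemma ins_inject:
  assumes "z \<notin> set us" "z \<notin> set us'" "k \<le> length us" "k' \<le> length us'"
    "ins z us k = ins z us' k'"
  shows "us = us' \<and> k = k'"
proof -
  have z: "z \<notin> set (take k us)" "z \<notin> set (drop k us)"
    using assms by (meson in_set_takeD in_set_dropD)+
  have "take k us = take k' us' \<and> drop k us = drop k' us'"
    using assms(5) z unfolding ins_def by (simp add: append_Cons_eq_iff)
  moreover from this have "k = k'"
    using assms(3,4) by (metis length_take min.absorb2)
  ultimately show ?thesis by (metis append_take_drop_id)
qed

lemma split_distinct:
  assumes "distinct zs" "z \<in> set zs"
  obtains us k where "zs = ins z us k" "k \<le> length us" "distinct us" "z \<notin> set us"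
proof -
  obtain xs ys where zs: "zs = xs @ z # ys" using assms(2) by (meson split_list)
  show ?thesis
  proof (rule that)
    show "zs = ins z (xs @ ys) (length xs)" by (simp add: zs ins_def)
  qed (use assms(1) zs in auto)
qed

lemma finite_distinct_lists: "finite E \<Longrightarrow> finite {us. distinct us \<and> set us \<subseteq> E}"
  by (rule finite_subset[OF _ finite_lists_length_le[of E "card E"]])
    (auto simp: distinct_card[symmetric] card_mono)

lemma replicate_separator_inject:
  assumes "p \<noteq> q" "replicate k p @ q # l = replicate k' p @ q # l'"
  shows "k = k' \<and> l = l'"
  using assms(2)
proof (induction k arbitrary: k')
  case 0
  then show ?case using assms(1) by (cases k') auto
next
  case (Suc k)
  then show ?case using assms(1) by (cases k') auto
qed

text \<open>The image under an inner automorphism.\<close>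

lemma subgroup_conjugate:
  assumes "group K" "subgroup H K" "g \<in> carrier K"
  shows "subgroup ((g <#\<^bsub>K\<^esub> H) #>\<^bsub>K\<^esub> inv\<^bsub>K\<^esub> g) K"
proof -
  interpret K: group K by fact
  have "group_hom K K (\<lambda>h. g \<otimes>\<^bsub>K\<^esub> h \<otimes>\<^bsub>K\<^esub> inv\<^bsub>K\<^esub> g)"
  proof (intro group_hom.intro group_hom_axioms.intro homI)
    fix x y assume xy: "x \<in> carrier K" "y \<in> carrier K"
    have "inv\<^bsub>K\<^esub> g \<otimes>\<^bsub>K\<^esub> (g \<otimes>\<^bsub>K\<^esub> (y \<otimes>\<^bsub>K\<^esub> inv\<^bsub>K\<^esub> g)) = y \<otimes>\<^bsub>K\<^esub> inv\<^bsub>K\<^esub> g"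
      using xy assms(3) by (simp add: K.m_assoc[symmetric])
    then show "g \<otimes>\<^bsub>K\<^esub> (x \<otimes>\<^bsub>K\<^esub> y) \<otimes>\<^bsub>K\<^esub> inv\<^bsub>K\<^esub> g =
        g \<otimes>\<^bsub>K\<^esub> x \<otimes>\<^bsub>K\<^esub> inv\<^bsub>K\<^esub> g \<otimes>\<^bsub>K\<^esub> (g \<otimes>\<^bsub>K\<^esub> y \<otimes>\<^bsub>K\<^esub> inv\<^bsub>K\<^esub> g)"
      using xy assms(3) by (simp add: K.m_assoc)
  qed (use assms in auto)
  then have "subgroup ((\<lambda>h. g \<otimes>\<^bsub>K\<^esub> h \<otimes>\<^bsub>K\<^esub> inv\<^bsub>K\<^esub> g) ` H) K"
    using assms(2) by (rule group_hom.subgroup_img_is_subgroup)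
  moreover have "(\<lambda>h. g \<otimes>\<^bsub>K\<^esub> h \<otimes>\<^bsub>K\<^esub> inv\<^bsub>K\<^esub> g) ` H = (g <#\<^bsub>K\<^esub> H) #>\<^bsub>K\<^esub> inv\<^bsub>K\<^esub> g"
    by (auto simp: l_coset_def r_coset_def)
  ultimately show ?thesis by simp
qed


section \<open>Automorphisms of the generic structure\<close>

locale generic_structure =
  fixes M :: "'a lstruct"
  assumes generic: "is_generic M"
begin

abbreviation A :: "'a set" where "A \<equiv> univ M"
abbreviation lt :: "'a \<Rightarrow> 'a \<Rightarrow> bool"  (infix "\<prec>" 50) where "x \<prec> y \<equiv> (x, y) \<in> less_rel M"
abbreviation R :: "nat \<Rightarrow> 'a list set" where "R \<equiv> R_rel M"
abbreviation G :: "('a \<Rightarrow> 'a) set" where "G \<equiv> carrier (aut_group M)"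

lemma countable_A: "countable A" and infinite_A: "infinite A"
  using generic by (auto simp: is_generic_def)

lemma slo: "trans (less_rel M)" "irrefl (less_rel M)" "total_on A (less_rel M)"
  using generic by (simp_all add: is_generic_def models_T0_def strict_linear_order_on_def)

lemma lt_trans: "x \<prec> y \<Longrightarrow> y \<prec> z \<Longrightarrow> x \<prec> z"
  using slo(1) by (rule transD)

lemma lt_irrefl: "\<not> x \<prec> x"
  using slo(2) by (simp add: irrefl_def)

lemma lt_total: "x \<in> A \<Longrightarrow> y \<in> A \<Longrightarrow> x \<noteq> y \<Longrightarrow> x \<prec> y \<or> y \<prec> x"
  using slo(3) by (simp add: total_on_def)

lemma lt_asym: "x \<prec> y \<Longrightarrow> \<not> y \<prec> x"
  using lt_trans lt_irrefl by blast

lemma R_props: "zs \<in> R n \<Longrightarrow> length zs = Suc n \<and> set zs \<subseteq> A \<and> distinct zs"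
  using generic by (auto simp: is_generic_def models_T0_def is_lstruct_def)

lemma homogeneous:
  assumes "finite S" "S \<subseteq> A" "finite T" "T \<subseteq> A" "lisomorphism f (substruct M S) (substruct M T)"
  obtains g where "lisomorphism g M M" "\<And>x. x \<in> S \<Longrightarrow> g x = f x"
proof -
  have "\<forall>S T f. finite S \<and> S \<subseteq> A \<and> finite T \<and> T \<subseteq> A \<and>
      lisomorphism f (substruct M S) (substruct M T) \<longrightarrow>
      (\<exists>g. lisomorphism g M M \<and> (\<forall>x \<in> S. g x = f x))"
    using generic unfolding is_generic_def by (elim conjE)
  then show ?thesis using assms that by (metis (no_types, lifting))
qed

lemma G_iff: "g \<in> G \<longleftrightarrow> g \<in> Bij A \<and> lisomorphism g M M"
  by (simp add: aut_group_def)

lemma G_bij: "g \<in> G \<Longrightarrow> bij_betw g A A"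
  by (simp add: G_iff Bij_def)

lemma G_in: "g \<in> G \<Longrightarrow> x \<in> A \<Longrightarrow> g x \<in> A"
  using G_bij bij_betwE by blast

lemma G_inj: "g \<in> G \<Longrightarrow> x \<in> A \<Longrightarrow> y \<in> A \<Longrightarrow> g x = g y \<longleftrightarrow> x = y"
  using G_bij by (metis bij_betw_def inj_on_eq_iff)

lemma G_image: "g \<in> G \<Longrightarrow> D \<subseteq> A \<Longrightarrow> g ` D \<subseteq> A"
  using G_in by blast

lemma G_lt: "g \<in> G \<Longrightarrow> x \<in> A \<Longrightarrow> y \<in> A \<Longrightarrow> g x \<prec> g y \<longleftrightarrow> x \<prec> y"
  by (simp add: G_iff lisomorphism_def lembedding_def)

lemma G_R: assumes "g \<in> G" "set zs \<subseteq> A" shows "map g zs \<in> R n \<longleftrightarrow> zs \<in> R n"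
proof (cases "length zs = Suc n")
  case True
  then show ?thesis using assms by (auto simp: G_iff lisomorphism_def lembedding_def)
next
  case False
  then show ?thesis using R_props by force
qed

lemma G_intro:
  assumes "lisomorphism g M M" shows "restrict g A \<in> G"
proof -
  have emb: "lembedding (restrict g A) M M"
    unfolding lembedding_def
  proof (intro conjI allI impI ballI)
    show "inj_on (restrict g A) A" "restrict g A ` A \<subseteq> A"
      using assms by (auto simp: lisomorphism_def lembedding_def)
  next
    fix x y assume "x \<in> A" "y \<in> A"
    then show "x \<prec> y \<longleftrightarrow> restrict g A x \<prec> restrict g A y"
      using assms by (auto simp: lisomorphism_def lembedding_def)
  next
    fix n zs assume *: "length zs = Suc n \<and> set zs \<subseteq> A"
    then have "map (restrict g A) zs = map g zs" by auto
    moreover have "zs \<in> R n \<longleftrightarrow> map g zs \<in> R n"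
      using assms * unfolding lisomorphism_def lembedding_def by blast
    ultimately show "zs \<in> R n \<longleftrightarrow> map (restrict g A) zs \<in> R n"
      by (simp only:)
  qed
  moreover have "bij_betw (restrict g A) A A"
    using assms by (auto simp: bij_betw_def lisomorphism_def lembedding_def)
  ultimately show ?thesis
    by (auto simp: G_iff Bij_def lisomorphism_def bij_betw_def)
qed

lemma lisomorphism_id: "lisomorphism (\<lambda>x. x) M M"
  by (auto simp: lisomorphism_def lembedding_def)

lemma lisomorphism_comp:
  assumes "g \<in> G" "h \<in> G" shows "lisomorphism (\<lambda>x. g (h x)) M M"
  unfolding lisomorphism_def lembedding_def
proof (intro conjI allI impI ballI)
  show "inj_on (\<lambda>x. g (h x)) A" using assms by (auto simp: inj_on_def G_inj G_in)
  show "(\<lambda>x. g (h x)) ` A = A"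
    using G_bij[OF assms(1)] G_bij[OF assms(2)] by (auto simp: bij_betw_def image_image[symmetric])
  then show "(\<lambda>x. g (h x)) ` A \<subseteq> A" by simp
next
  fix x y assume "x \<in> A" "y \<in> A"
  then show "x \<prec> y \<longleftrightarrow> g (h x) \<prec> g (h y)" using assms by (simp add: G_lt G_in)
next
  fix n zs assume "length zs = Suc n \<and> set zs \<subseteq> A"
  then have "map g (map h zs) \<in> R n \<longleftrightarrow> zs \<in> R n"
    using assms by (subst G_R) (auto simp: G_R G_in)
  then show "zs \<in> R n \<longleftrightarrow> map (\<lambda>x. g (h x)) zs \<in> R n" by (simp add: comp_def)
qed

lemma G_comp: "g \<in> G \<Longrightarrow> h \<in> G \<Longrightarrow> restrict (\<lambda>x. g (h x)) A \<in> G"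
  by (intro G_intro lisomorphism_comp)

text \<open>The inverse in the automorphism group, where permutations are undefined outside of
  \<open>A\<close>.\<close>

definition ginv :: "('a \<Rightarrow> 'a) \<Rightarrow> 'a \<Rightarrow> 'a" where "ginv g = restrict (inv_into A g) A"

lemma ginv_left: "g \<in> G \<Longrightarrow> x \<in> A \<Longrightarrow> ginv g (g x) = x"
  unfolding ginv_def using G_bij G_in by (metis bij_betw_inv_into_left restrict_apply')

lemma ginv_right: "g \<in> G \<Longrightarrow> x \<in> A \<Longrightarrow> g (ginv g x) = x"
  unfolding ginv_def using G_bij by (metis bij_betw_inv_into_right restrict_apply')

lemma ginv_in: "g \<in> G \<Longrightarrow> x \<in> A \<Longrightarrow> ginv g x \<in> A"
  unfolding ginv_def using G_bij by (metis bij_betwE bij_betw_inv_into restrict_apply')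

lemma ginv_G: assumes "g \<in> G" shows "ginv g \<in> G"
proof -
  have "lisomorphism (ginv g) M M"
    unfolding lisomorphism_def lembedding_def
  proof (intro conjI allI impI ballI)
    show "inj_on (ginv g) A" using assms by (metis ginv_right inj_onI)
    show "ginv g ` A \<subseteq> A" using assms ginv_in by blast
    show "ginv g ` A = A"
    proof
      show "A \<subseteq> ginv g ` A" using assms by (metis G_in ginv_left image_eqI subsetI)
    qed (use assms ginv_in in blast)
  next
    fix x y assume "x \<in> A" "y \<in> A"
    then show "x \<prec> y \<longleftrightarrow> ginv g x \<prec> ginv g y"
      using assms by (metis G_lt ginv_in ginv_right)
  next
    fix n zs assume "length zs = Suc n \<and> set zs \<subseteq> A"
    then have "map g (map (ginv g) zs) = zs" "set (map (ginv g) zs) \<subseteq> A"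
      using assms by (auto simp: ginv_right ginv_in subset_iff intro!: map_idI)
    then show "zs \<in> R n \<longleftrightarrow> map (ginv g) zs \<in> R n"
      using assms by (metis G_R)
  qed
  then have "restrict (ginv g) A \<in> G" by (rule G_intro)
  then show ?thesis by (simp add: ginv_def)
qed

lemma ginv_fix: "g \<in> G \<Longrightarrow> x \<in> A \<Longrightarrow> g x = x \<Longrightarrow> ginv g x = x"
  by (metis ginv_left)

lemma group_aut: "subgroup G (BijGroup A)"
proof (rule subgroup.intro)
  show "G \<subseteq> carrier (BijGroup A)" by (auto simp: G_iff BijGroup_def)
  fix g h assume gh: "g \<in> G" "h \<in> G"
  have "compose A g h = restrict (\<lambda>x. g (h x)) A" by (simp add: compose_def)
  then show "g \<otimes>\<^bsub>BijGroup A\<^esub> h \<in> G"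
    using gh G_comp[OF gh] by (simp add: BijGroup_def G_iff)
next
  show "\<one>\<^bsub>BijGroup A\<^esub> \<in> G" using G_intro[OF lisomorphism_id] by (simp add: BijGroup_def)
next
  fix g assume "g \<in> G"
  then show "inv\<^bsub>BijGroup A\<^esub> g \<in> G"
    using ginv_G[of g] by (simp add: G_iff inv_BijGroup ginv_def)
qed


section \<open>Realising one-point types\<close>

text \<open>The one-point types over a finite set \<open>U\<close> that are not realised in \<open>U\<close> are given by a cut
  \<open>C\<close> of \<open>U\<close> and by arbitrary data \<open>T\<close>: \<open>(us, k) \<in> T\<close> says that the relation holds for the list
  \<open>us\<close> over \<open>U\<close> with the new point inserted at position \<open>k\<close>. Each of them is
  realised: \<open>U\<close> with an added point is a finite structure, which embeds in \<open>M\<close>, and homogeneity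
  moves the image of \<open>U\<close> back to \<open>U\<close>.\<close>

lemma realise_type:
  assumes U: "finite U" "U \<subseteq> A"
    and C: "C \<subseteq> U" "\<forall>c \<in> C. \<forall>u \<in> U - C. c \<prec> u"
  shows "\<exists>z. z \<in> A \<and> z \<notin> U \<and> (\<forall>u \<in> U. u \<prec> z \<longleftrightarrow> u \<in> C) \<and>
    (\<forall>us k. distinct us \<and> set us \<subseteq> U \<and> k \<le> length us \<longrightarrow>
        (ins z us k \<in> R (length us) \<longleftrightarrow> (us, k) \<in> T))"
proof -
  \<comment> \<open>The element \<open>p\<close> is only a name for the point added to \<open>U\<close>.\<close>
  obtain p where p: "p \<in> A" "p \<notin> U"
    using U infinite_A by (metis finite_subset subsetI)
  define N where "N = \<lparr>univ = insert p U,
      less_rel = less_rel M \<inter> U \<times> U \<union> C \<times> {p} \<union> {p} \<times> (U - C),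
      R_rel = (\<lambda>n. {zs \<in> R n. set zs \<subseteq> U} \<union>
         {ins p us k | us k. distinct us \<and> set us \<subseteq> U \<and> k \<le> length us \<and> (us, k) \<in> T
             \<and> length us = n})\<rparr>"
  have down: "x \<in> C" if "x \<prec> y" "y \<in> C" "x \<in> U" for x y
    using C(2) lt_asym[of x y] that by blast
  have "models_T0 N"
    unfolding models_T0_def
  proof (intro conjI allI ballI)
    show "is_lstruct N"
      unfolding is_lstruct_def N_def using C(1) R_props by auto
    show "strict_linear_order_on (univ N) (less_rel N)"
      unfolding strict_linear_order_on_def
    proof (intro conjI)
      show "irrefl (less_rel N)" using p C(1) lt_irrefl by (auto simp: N_def irrefl_def)
      show "total_on (univ N) (less_rel N)"
        using p U lt_total by (auto simp: N_def total_on_def subset_iff)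
      show "trans (less_rel N)"
      proof (rule transI)
        fix x y z assume xy: "(x, y) \<in> less_rel N" and yz: "(y, z) \<in> less_rel N"
        consider "x \<prec> y" "x \<in> U" "y \<in> U" | "x \<in> C" "y = p" | "x = p" "y \<in> U - C"
          using xy by (auto simp: N_def)
        then show "(x, z) \<in> less_rel N"
        proof cases
          case 1
          then show ?thesis using yz p down[of x y] by (auto simp: N_def dest: lt_trans)
        next
          case 2
          then show ?thesis using yz p C by (auto simp: N_def)
        next
          case 3
          then show ?thesis using yz p down[of y z] by (auto simp: N_def)
        qed
      qed
    qed
  next
    fix n zs assume "zs \<in> R_rel N n"
    then show "distinct zs"
      using p R_props by (auto simp: N_def distinct_ins)
  qed
  moreover have "finite (univ N)" using U by (simp add: N_def)
  ultimately obtain f where f: "lembedding f N M"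
    using generic by (auto simp: is_generic_def)
  have f_inj: "inj_on f (insert p U)" and f_A: "f ` insert p U \<subseteq> A"
    and f_lt: "\<And>x y. x \<in> insert p U \<Longrightarrow> y \<in> insert p U \<Longrightarrow> (x, y) \<in> less_rel N \<longleftrightarrow> f x \<prec> f y"
    and f_R: "\<And>n zs. length zs = Suc n \<Longrightarrow> set zs \<subseteq> insert p U \<Longrightarrow>
        zs \<in> R_rel N n \<longleftrightarrow> map f zs \<in> R n"
  proof -
    have N: "univ N = insert p U" by (simp add: N_def)
    note f' = f[unfolded lembedding_def N]
    show "inj_on f (insert p U)" "f ` insert p U \<subseteq> A"
      using f' by blast+
    show "\<And>x y. x \<in> insert p U \<Longrightarrow> y \<in> insert p U \<Longrightarrow> (x, y) \<in> less_rel N \<longleftrightarrow> f x \<prec> f y"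
      using f' by blast
    show "\<And>n zs. length zs = Suc n \<Longrightarrow> set zs \<subseteq> insert p U \<Longrightarrow>
        zs \<in> R_rel N n \<longleftrightarrow> map f zs \<in> R n"
      using f' by blast
  qed
  define h where "h = inv_into U f"
  have injU: "inj_on f U" using f_inj by (auto simp: inj_on_def)
  have hf: "h (f u) = u" if "u \<in> U" for u
    using that injU by (simp add: h_def)
  have N_U_R: "zs \<in> R_rel N n \<longleftrightarrow> zs \<in> R n" if "set zs \<subseteq> U" for zs n
    using that p by (auto simp: N_def)
  have "lisomorphism h (substruct M (f ` U)) (substruct M U)"
    unfolding lisomorphism_def lembedding_def
  proof (intro conjI allI impI ballI)
    show "inj_on h (univ (substruct M (f ` U)))"
      using hf by (auto simp: substruct_def inj_on_def)
    show "h ` univ (substruct M (f ` U)) = univ (substruct M U)"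
      using hf by (force simp: substruct_def)
    then show "h ` univ (substruct M (f ` U)) \<subseteq> univ (substruct M U)" by simp
  next
    fix x y assume "x \<in> univ (substruct M (f ` U))" "y \<in> univ (substruct M (f ` U))"
    then obtain a b where ab: "x = f a" "y = f b" "a \<in> U" "b \<in> U" by (auto simp: substruct_def)
    have "a \<prec> b \<longleftrightarrow> f a \<prec> f b" using f_lt[of a b] ab p by (auto simp: N_def)
    then show "(x, y) \<in> less_rel (substruct M (f ` U)) \<longleftrightarrow> (h x, h y) \<in> less_rel (substruct M U)"
      using ab hf by (simp add: substruct_def)
  next
    fix n zs assume zs: "length zs = Suc n \<and> set zs \<subseteq> univ (substruct M (f ` U))"
    then have "set (map h zs) \<subseteq> U" using hf by (auto simp: substruct_def)
    moreover have "map f (map h zs) = zs"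
      using zs hf by (auto simp: substruct_def intro!: map_idI)
    ultimately have "map h zs \<in> R n \<longleftrightarrow> zs \<in> R n"
      using f_R[of "map h zs" n] N_U_R[of "map h zs" n] zs by auto
    then show "zs \<in> R_rel (substruct M (f ` U)) n \<longleftrightarrow> map h zs \<in> R_rel (substruct M U) n"
      using zs \<open>set (map h zs) \<subseteq> U\<close> by (auto simp: substruct_def)
  qed
  moreover have "finite (f ` U)" "f ` U \<subseteq> A" using U f_A by auto
  ultimately obtain g where g: "lisomorphism g M M" "\<And>x. x \<in> f ` U \<Longrightarrow> g x = h x"
    using homogeneous[of "f ` U" U h] U by metis
  define g' where "g' = restrict g A"
  have g'G: "g' \<in> G" unfolding g'_def using g(1) by (rule G_intro)
  have g'f: "g' (f u) = u" if "u \<in> U" for u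
    using that g(2)[of "f u"] hf f_A by (auto simp: g'_def)
  show ?thesis
  proof (intro exI[of _ "g' (f p)"] conjI ballI allI impI)
    show "g' (f p) \<in> A" using g'G f_A G_in by blast
    show "g' (f p) \<notin> U"
    proof
      assume "g' (f p) \<in> U"
      then have "g' (f (g' (f p))) = g' (f p)" by (rule g'f)
      then have "f (g' (f p)) = f p"
        using g'G f_A \<open>g' (f p) \<in> U\<close> by (subst (asm) G_inj) auto
      then show False using f_inj \<open>g' (f p) \<in> U\<close> p by (auto simp: inj_on_def)
    qed
  next
    fix u assume u: "u \<in> U"
    have "u \<prec> g' (f p) \<longleftrightarrow> g' (f u) \<prec> g' (f p)" using u g'f by simp
    also have "\<dots> \<longleftrightarrow> f u \<prec> f p" using u g'G f_A by (intro G_lt) auto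
    also have "\<dots> \<longleftrightarrow> (u, p) \<in> less_rel N" using u f_lt by simp
    also have "\<dots> \<longleftrightarrow> u \<in> C" using u p by (auto simp: N_def)
    finally show "u \<prec> g' (f p) \<longleftrightarrow> u \<in> C" .
  next
    fix us k assume us: "distinct us \<and> set us \<subseteq> U \<and> k \<le> length us"
    have "map g' (map f us) = us" using us g'f by (auto intro!: map_idI)
    then have "ins (g' (f p)) us k = map g' (map f (ins p us k))" by (simp only: map_ins)
    moreover have "map g' (map f (ins p us k)) \<in> R (length us) \<longleftrightarrow> map f (ins p us k) \<in> R (length us)"
      using g'G f_A us by (intro G_R) auto
    moreover have "\<dots> \<longleftrightarrow> ins p us k \<in> R_rel N (length us)"
      using us by (intro f_R[symmetric]) auto
    moreover have "\<dots> \<longleftrightarrow> (us, k) \<in> T"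
    proof
      assume "ins p us k \<in> R_rel N (length us)"
      then obtain us' k' where "ins p us k = ins p us' k'" "set us' \<subseteq> U" "k' \<le> length us'"
          "(us', k') \<in> T" using p by (auto simp: N_def)
      then show "(us, k) \<in> T" using ins_inject[of p us us' k k'] us p by auto
    qed (use us in \<open>auto simp: N_def\<close>)
    ultimately show "ins (g' (f p)) us k \<in> R (length us) \<longleftrightarrow> (us, k) \<in> T" by simp
  qed
qed

text \<open>Homogeneity for one-point extensions: points of the same type over \<open>U\<close> are conjugate.\<close>

lemma same_type_conjugate:
  assumes U: "finite U" "U \<subseteq> A" and xy: "x \<in> A - U" "y \<in> A - U"
    and lt: "\<And>u. u \<in> U \<Longrightarrow> u \<prec> x \<longleftrightarrow> u \<prec> y"
    and R: "\<And>us k. distinct us \<Longrightarrow> set us \<subseteq> U \<Longrightarrow> k \<le> length us \<Longrightarrow>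
        ins x us k \<in> R (length us) \<longleftrightarrow> ins y us k \<in> R (length us)"
  obtains g where "g \<in> G" "\<And>u. u \<in> U \<Longrightarrow> g u = u" "g x = y"
proof -
  define f where "f = (\<lambda>u. if u = x then y else u)"
  have fU: "f u = u" if "u \<in> U" for u using that xy by (auto simp: f_def)
  have gt: "x \<prec> u \<longleftrightarrow> y \<prec> u" if "u \<in> U" for u
    using lt[OF that] lt_total[of x u] lt_total[of y u] lt_asym that xy U by blast
  have "lisomorphism f (substruct M (insert x U)) (substruct M (insert y U))"
    unfolding lisomorphism_def lembedding_def
  proof (intro conjI allI impI ballI)
    show "inj_on f (univ (substruct M (insert x U)))"
      using xy by (auto simp: substruct_def inj_on_def f_def)
    show "f ` univ (substruct M (insert x U)) = univ (substruct M (insert y U))"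
      using xy by (auto simp: substruct_def f_def)
    then show "f ` univ (substruct M (insert x U)) \<subseteq> univ (substruct M (insert y U))" by simp
  next
    fix a b assume "a \<in> univ (substruct M (insert x U))" "b \<in> univ (substruct M (insert x U))"
    then show "(a, b) \<in> less_rel (substruct M (insert x U)) \<longleftrightarrow>
        (f a, f b) \<in> less_rel (substruct M (insert y U))"
      using lt gt lt_irrefl fU by (auto simp: substruct_def f_def)
  next
    fix n zs assume zs: "length zs = Suc n \<and> set zs \<subseteq> univ (substruct M (insert x U))"
    then have sub: "set zs \<subseteq> insert x U" "set (map f zs) \<subseteq> insert y U"
      using fU by (auto simp: substruct_def f_def)
    have "zs \<in> R n \<longleftrightarrow> map f zs \<in> R n"
    proof (cases "distinct zs \<and> x \<in> set zs")
      case True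
      then obtain us k where us: "zs = ins x us k" "k \<le> length us" "distinct us" "x \<notin> set us"
        using split_distinct by metis
      then have "map f us = us" using sub fU by (auto intro!: map_idI)
      then have "map f zs = ins y us k" using us by (simp add: map_ins f_def)
      then show ?thesis using R[of us k] us sub zs by auto
    next
      case False
      have "inj_on f (insert x U)" using xy by (auto simp: inj_on_def f_def)
      then have "distinct (map f zs) \<longleftrightarrow> distinct zs"
        using sub(1) by (metis distinct_map inj_on_subset)
      moreover have "map f zs = zs" if "x \<notin> set zs"
        using that by (intro map_idI) (auto simp: f_def)
      ultimately show ?thesis using False R_props by metis
    qed
    then show "zs \<in> R_rel (substruct M (insert x U)) n \<longleftrightarrow>
        map f zs \<in> R_rel (substruct M (insert y U)) n"
      using sub by (auto simp: substruct_def)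
  qed
  then obtain g where g: "lisomorphism g M M" "\<And>u. u \<in> insert x U \<Longrightarrow> g u = f u"
    using homogeneous[of "insert x U" "insert y U" f] U xy by auto
  show ?thesis
  proof
    show "restrict g A \<in> G" using g(1) by (rule G_intro)
    show "restrict g A u = u" if "u \<in> U" for u using that g(2)[of u] U fU by auto
    show "restrict g A x = y" using g(2)[of x] xy by (auto simp: f_def)
  qed
qed


section \<open>Supports of sets of atoms\<close>

text \<open>Lying in the same orbit of the pointwise stabiliser of \<open>E\<close>.\<close>

definition conj_over :: "'a set \<Rightarrow> 'a \<Rightarrow> 'a \<Rightarrow> bool" where
  "conj_over E x y \<longleftrightarrow> (\<exists>g \<in> G. (\<forall>e \<in> E. g e = e) \<and> g x = y)"

lemma conj_over_mono: "conj_over E x y \<Longrightarrow> F \<subseteq> E \<Longrightarrow> conj_over F x y"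
  unfolding conj_over_def by blast

lemma conj_over_sym:
  assumes "conj_over E x y" "E \<subseteq> A" "x \<in> A" shows "conj_over E y x"
proof -
  obtain g where g: "g \<in> G" "\<forall>e \<in> E. g e = e" "g x = y"
    using assms(1) by (auto simp: conj_over_def)
  then show ?thesis
    unfolding conj_over_def using assms(2,3)
    by (intro bexI[of _ "ginv g"]) (auto simp: ginv_G ginv_left intro: ginv_fix)
qed

lemma conj_over_trans:
  assumes "conj_over E x y" "conj_over E y z" "E \<subseteq> A" "x \<in> A" shows "conj_over E x z"
proof -
  obtain g h where "g \<in> G" "\<forall>e \<in> E. g e = e" "g x = y" "h \<in> G" "\<forall>e \<in> E. h e = e" "h y = z"
    using assms(1,2) by (auto simp: conj_over_def)
  then show ?thesis
    unfolding conj_over_def using assms(3,4)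
    by (intro bexI[of _ "restrict (\<lambda>x. h (g x)) A"]) (auto simp: G_comp subset_iff)
qed

definition supports :: "'a set \<Rightarrow> 'a set \<Rightarrow> bool" where
  "supports E D \<longleftrightarrow> finite E \<and> E \<subseteq> A \<and> D \<subseteq> A \<and>
     (\<forall>g \<in> G. (\<forall>e \<in> E. g e = e) \<longrightarrow> (\<forall>x \<in> D. g x \<in> D))"

lemma supports_conj:
  assumes "supports E D" "conj_over E x y" "x \<in> A" shows "x \<in> D \<longleftrightarrow> y \<in> D"
proof -
  have *: "b \<in> D" if "conj_over E a b" "a \<in> D" for a b
    using assms(1) that by (auto simp: supports_def conj_over_def)
  show ?thesis
    using *[OF assms(2)] *[OF conj_over_sym[OF assms(2)]] assms by (auto simp: supports_def)
qed

lemma supportsI: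
  assumes "finite E" "E \<subseteq> A" "D \<subseteq> A" "\<And>x y. x \<in> D \<Longrightarrow> conj_over E x y \<Longrightarrow> y \<in> D"
  shows "supports E D"
  using assms unfolding supports_def conj_over_def by blast

lemma supports_image:
  assumes "supports E D" "g \<in> G" "\<And>e. e \<in> E \<Longrightarrow> g e = e" shows "g ` D = D"
proof
  show "g ` D \<subseteq> D" using assms by (auto simp: supports_def)
  show "D \<subseteq> g ` D"
  proof
    fix x assume x: "x \<in> D"
    then have "x \<in> A" using assms by (auto simp: supports_def)
    moreover have "ginv g x \<in> D"
      using assms x ginv_G ginv_fix unfolding supports_def by (metis subsetD)
    ultimately show "x \<in> g ` D" using assms(2) ginv_right by (metis image_eqI)
  qed
qed

lemma supports_mono: "supports E D \<Longrightarrow> E \<subseteq> F \<Longrightarrow> finite F \<Longrightarrow> F \<subseteq> A \<Longrightarrow> supports F D"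
  unfolding supports_def by blast

text \<open>If \<open>g\<close> fixes \<open>h ` E\<close>, then the conjugate of \<open>g\<close> by \<open>h\<close> fixes
  \<open>E\<close>.\<close>

lemma supports_translate:
  assumes "supports E D" "h \<in> G" shows "supports (h ` E) (h ` D)"
  unfolding supports_def
proof (intro conjI ballI impI)
  show "finite (h ` E)" "h ` E \<subseteq> A" "h ` D \<subseteq> A"
    using assms G_image by (auto simp: supports_def)
  fix g x assume g: "g \<in> G" "\<forall>e \<in> h ` E. g e = e" and x: "x \<in> h ` D"
  then obtain d where d: "d \<in> D" "x = h d" by auto
  have sub: "E \<subseteq> A" "D \<subseteq> A" using assms(1) by (auto simp: supports_def)
  define k where "k = restrict (\<lambda>x. ginv h (restrict (\<lambda>x. g (h x)) A x)) A"
  have "k \<in> G" unfolding k_def by (intro G_comp ginv_G assms g)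
  moreover have "\<forall>e \<in> E. k e = e" using g sub assms by (auto simp: k_def ginv_left subset_iff)
  ultimately have "k d \<in> D" using assms(1) d by (auto simp: supports_def)
  moreover have "h (k d) = g x" using d sub assms g by (auto simp: k_def ginv_right G_in subset_iff)
  ultimately show "g x \<in> h ` D" by (metis image_eqI)
qed

text \<open>No algebraicity: the orbit of a point outside of \<open>E\<close> under the automorphisms that fix
  \<open>E\<close> is infinite.\<close>

lemma escape:
  assumes "finite E" "E \<subseteq> A" "finite W" "W \<subseteq> A" "x \<in> A" "x \<notin> E"
  obtains z where "z \<in> A" "z \<notin> E" "z \<notin> W" "conj_over E x z"
proof -
  let ?C = "{u \<in> E \<union> W. u \<prec> x}"
  have cut: "\<forall>c \<in> ?C. \<forall>u \<in> E \<union> W - ?C. c \<prec> u"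
  proof (intro ballI)
    fix c u assume "c \<in> ?C" "u \<in> E \<union> W - ?C"
    then show "c \<prec> u" using assms lt_total[of u x] lt_trans[of c x u] by auto
  qed
  have U: "finite (E \<union> W)" "E \<union> W \<subseteq> A" "?C \<subseteq> E \<union> W" using assms by auto
  obtain z where z: "z \<in> A" "z \<notin> E \<union> W"
    "\<And>u. u \<in> E \<union> W \<Longrightarrow> u \<prec> z \<longleftrightarrow> u \<in> ?C"
    "\<And>us k. distinct us \<Longrightarrow> set us \<subseteq> E \<union> W \<Longrightarrow> k \<le> length us \<Longrightarrow>
        ins z us k \<in> R (length us) \<longleftrightarrow> (us, k) \<in> {(us, k). ins x us k \<in> R (length us)}"
    using realise_type[OF U cut, of "{(us, k). ins x us k \<in> R (length us)}"] by blast
  have "conj_over E x z"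
  proof (rule same_type_conjugate[of E x z])
    show "u \<prec> x \<longleftrightarrow> u \<prec> z" if "u \<in> E" for u using z(3)[of u] that by auto
    show "ins x us k \<in> R (length us) \<longleftrightarrow> ins z us k \<in> R (length us)"
      if "distinct us" "set us \<subseteq> E" "k \<le> length us" for us k
      using z(4)[of us k] that by auto
  qed (use assms z in \<open>auto simp: conj_over_def\<close>)
  then show ?thesis using that z by blast
qed

text \<open>The amalgamation step for supports: a point \<open>z\<close> with the type of \<open>x\<close> over
  \<open>F\<close>, \<open>a\<close> and the type of \<open>y\<close> over \<open>F\<close>, \<open>b\<close> transfers membership in
  \<open>D\<close> from \<open>x\<close> to \<open>y\<close>. The condition on the order says that the two cuts do not
  contradict each other.\<close>

lemma supports_conj_fresh:
  assumes "finite F" "F \<subseteq> A" "a \<in> A" "b \<in> A" "a \<noteq> b" "a \<notin> F" "b \<notin> F"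
    and D: "supports (insert a F) D" "supports (insert b F) D"
    and x: "x \<in> A" "x \<notin> F" "x \<noteq> a" "x \<noteq> b"
    and y: "y \<in> A" "y \<notin> F" "y \<noteq> a" "y \<noteq> b"
    and xy: "conj_over F x y"
    and order: "\<not> (a \<prec> x \<and> y \<prec> b \<and> b \<prec> a)" "\<not> (b \<prec> y \<and> x \<prec> a \<and> a \<prec> b)"
  shows "x \<in> D \<longleftrightarrow> y \<in> D"
proof -
  obtain g where g: "g \<in> G" "\<forall>e \<in> F. g e = e" "g x = y" using xy by (auto simp: conj_over_def)
  define U where "U = insert a (insert b F)"
  define C where "C = {u \<in> U. (u \<noteq> b \<and> u \<prec> x) \<or> (u \<noteq> a \<and> u \<prec> y)}"
  define T where "T = {(us, k). (set us \<subseteq> insert a F \<and> ins x us k \<in> R (length us)) \<or>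
      (set us \<subseteq> insert b F \<and> ins y us k \<in> R (length us))}"
  have U: "finite U" "U \<subseteq> A" using assms by (auto simp: U_def)
  have F_lt: "u \<prec> x \<longleftrightarrow> u \<prec> y" if "u \<in> F" for u
    using G_lt[OF g(1), of u x] g that assms by auto
  have C_F: "u \<in> C \<longleftrightarrow> u \<prec> x" "u \<in> C \<longleftrightarrow> u \<prec> y" if "u \<in> F" for u
    using that F_lt assms by (auto simp: C_def U_def)
  have C_a: "a \<in> C \<longleftrightarrow> a \<prec> x" and C_b: "b \<in> C \<longleftrightarrow> b \<prec> y"
    using assms(5) by (auto simp: C_def U_def)
  have cut: "c \<prec> u" if "c \<prec> w" "\<not> u \<prec> w" "u \<in> U" "w \<in> A" "u \<noteq> w" for c u w
    using that lt_total[of u w] lt_trans U by blast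
  have down: "c \<prec> u" if c: "c \<in> C" and u: "u \<in> U" "u \<notin> C" for c u
  proof -
    have "c \<in> U" using c by (auto simp: C_def)
    then consider "c \<in> F" | "c = a" | "c = b" by (auto simp: U_def)
    then show ?thesis
    proof cases
      case 1
      have "c \<prec> x" "c \<prec> y" using C_F[OF 1] c by auto
      moreover have "\<not> u \<prec> x \<or> \<not> u \<prec> y" "u \<noteq> x" "u \<noteq> y"
        using u C_F C_a C_b assms by (auto simp: U_def)
      ultimately show ?thesis using cut u(1) assms by metis
    next
      case 2
      then have "a \<prec> x" using c C_a by simp
      consider "u \<in> F" | "u = b" using u 2 c by (auto simp: U_def)
      then show ?thesis
      proof cases
        case 1
        then show ?thesis using cut[of a x u] \<open>a \<prec> x\<close> u 2 C_F[of u] x by auto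
      next
        case 2
        then have "\<not> b \<prec> y" using u C_b by simp
        then have "y \<prec> b" using lt_total[of b y] y assms by auto
        then show ?thesis
          using order \<open>a \<prec> x\<close> \<open>c = a\<close> 2 lt_total[of a b] assms by auto
      qed
    next
      case 3
      then have "b \<prec> y" using c C_b by simp
      consider "u \<in> F" | "u = a" using u 3 c by (auto simp: U_def)
      then show ?thesis
      proof cases
        case 1
        then show ?thesis using cut[of b y u] \<open>b \<prec> y\<close> u 3 C_F[of u] y by auto
      next
        case 2
        then have "\<not> a \<prec> x" using u C_a by simp
        then have "x \<prec> a" using lt_total[of a x] x assms by auto
        then show ?thesis
          using order \<open>b \<prec> y\<close> \<open>c = b\<close> 2 lt_total[of a b] assms by auto
      qed
    qed
  qed
  have "C \<subseteq> U" by (auto simp: C_def)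
  obtain z where z: "z \<in> A" "z \<notin> U" "\<And>u. u \<in> U \<Longrightarrow> u \<prec> z \<longleftrightarrow> u \<in> C"
    "\<And>us k. distinct us \<Longrightarrow> set us \<subseteq> U \<Longrightarrow> k \<le> length us \<Longrightarrow>
        ins z us k \<in> R (length us) \<longleftrightarrow> (us, k) \<in> T"
    using realise_type[OF U \<open>C \<subseteq> U\<close>, of T] down by blast
  \<comment> \<open>The two halves of \<open>T\<close> only interact on lists over \<open>F\<close>, where \<open>g\<close> makes them agree.\<close>
  have F_R: "ins x us k \<in> R (length us) \<longleftrightarrow> ins y us k \<in> R (length us)" if "set us \<subseteq> F" for us k
  proof -
    have "map g us = us" using that g by (auto intro!: map_idI)
    then show ?thesis
      using G_R[OF g(1), of "ins x us k" "length us"] that x(1) assms(2) g(3) by (simp add: map_ins)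
  qed
  have "conj_over (insert a F) x z"
  proof (rule same_type_conjugate[of "insert a F" x z])
    show "u \<prec> x \<longleftrightarrow> u \<prec> z" if "u \<in> insert a F" for u
      using z(3)[of u] that C_F C_a by (auto simp: U_def)
    fix us k assume us: "distinct us" "set us \<subseteq> insert a F" "k \<le> length us"
    then have "set us \<subseteq> F" if "set us \<subseteq> insert b F" using that assms by blast
    then have "(us, k) \<in> T \<longleftrightarrow> ins x us k \<in> R (length us)"
      using us F_R by (auto simp: T_def)
    then show "ins x us k \<in> R (length us) \<longleftrightarrow> ins z us k \<in> R (length us)"
      using z(4)[of us k] us by (auto simp: U_def)
  qed (use assms z in \<open>auto simp: conj_over_def U_def\<close>)
  moreover have "conj_over (insert b F) y z"
  proof (rule same_type_conjugate[of "insert b F" y z])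
    show "u \<prec> y \<longleftrightarrow> u \<prec> z" if "u \<in> insert b F" for u
      using z(3)[of u] that C_F C_b by (auto simp: U_def)
    fix us k assume us: "distinct us" "set us \<subseteq> insert b F" "k \<le> length us"
    then have "set us \<subseteq> F" if "set us \<subseteq> insert a F" using that assms by blast
    then have "(us, k) \<in> T \<longleftrightarrow> ins y us k \<in> R (length us)"
      using us F_R by (auto simp: T_def)
    then show "ins y us k \<in> R (length us) \<longleftrightarrow> ins z us k \<in> R (length us)"
      using z(4)[of us k] us by (auto simp: U_def)
  qed (use assms z in \<open>auto simp: conj_over_def U_def\<close>)
  ultimately show ?thesis using supports_conj[OF D(1)] supports_conj[OF D(2)] x y by blast
qed

text \<open>Conjugate points \<open>x\<close> and \<open>y\<close> over \<open>F\<close> can first be moved off \<open>a\<close> and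
  \<open>b\<close>. Then the amalgamation step connects them unless \<open>x < a < b < y\<close> or
  \<open>y < b < a < x\<close>, and in these cases it works with \<open>a\<close> and \<open>b\<close> exchanged.\<close>

lemma supports_exchange:
  assumes "finite F" "F \<subseteq> A" "a \<in> A" "b \<in> A" "a \<noteq> b"
    and D: "supports (insert a F) D" "supports (insert b F) D"
  shows "supports F D"
proof (cases "a \<in> F \<or> b \<in> F")
  case True
  then show ?thesis using D by (auto simp: insert_absorb)
next
  case False
  then have ab: "a \<notin> F" "b \<notin> F" by auto
  have fresh: "\<exists>x'. x' \<in> A \<and> x' \<notin> F \<and> x' \<noteq> a \<and> x' \<noteq> b \<and> conj_over F x x' \<and> (x \<in> D \<longleftrightarrow> x' \<in> D)"
    if x: "x \<in> A" "x \<notin> F" for x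
  proof -
    \<comment> \<open>If \<open>x\<close> is \<open>a\<close>, only automorphisms fixing \<open>b\<close> can move it, and conversely.\<close>
    define c where "c = (if x = a then b else a)"
    have c: "c \<in> A" "x \<notin> insert c F" "supports (insert c F) D"
      using x assms by (auto simp: c_def)
    then obtain x' where x': "x' \<in> A" "x' \<notin> insert c F" "x' \<notin> {a, b}" "conj_over (insert c F) x x'"
      using escape[of "insert c F" "{a, b}" x] assms x by auto
    moreover have "conj_over F x x'" using x'(4) by (rule conj_over_mono) auto
    ultimately show ?thesis using supports_conj[OF c(3) x'(4) x(1)] by auto
  qed
  show ?thesis
  proof (rule supportsI)
    show "D \<subseteq> A" using D by (auto simp: supports_def)
    fix x y assume x: "x \<in> D" and xy: "conj_over F x y"
    then have xA: "x \<in> A" using D by (auto simp: supports_def)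
    then have yA: "y \<in> A" using xy G_in by (auto simp: conj_over_def)
    show "y \<in> D"
    proof (cases "x \<in> F")
      case True
      then show ?thesis using x xy by (auto simp: conj_over_def)
    next
      case False
      have yF: "y \<notin> F"
        using False conj_over_sym[OF xy assms(2) xA] by (auto simp: conj_over_def)
      obtain x' where x': "x' \<in> A" "x' \<notin> F" "x' \<noteq> a" "x' \<noteq> b" "conj_over F x x'" "x \<in> D \<longleftrightarrow> x' \<in> D"
        using fresh[OF xA False] by blast
      obtain y' where y': "y' \<in> A" "y' \<notin> F" "y' \<noteq> a" "y' \<noteq> b" "conj_over F y y'" "y \<in> D \<longleftrightarrow> y' \<in> D"
        using fresh[OF yA yF] by blast
      have xy': "conj_over F x' y'"
        by (meson assms(2) conj_over_sym conj_over_trans x'(1,5) xA xy y'(5) yA)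
      have "x' \<in> D \<longleftrightarrow> y' \<in> D"
      proof (cases "(a \<prec> x' \<and> y' \<prec> b \<and> b \<prec> a) \<or> (b \<prec> y' \<and> x' \<prec> a \<and> a \<prec> b)")
        case False
        then show ?thesis
          using supports_conj_fresh[of F a b D x' y'] assms ab x' y' xy' by blast
      next
        case True
        then have "\<not> (b \<prec> x' \<and> y' \<prec> a \<and> a \<prec> b)" "\<not> (a \<prec> y' \<and> x' \<prec> b \<and> b \<prec> a)"
          using lt_asym lt_trans by blast+
        then show ?thesis
          using supports_conj_fresh[of F b a D x' y'] assms ab x' y' xy' by blast
      qed
      then show ?thesis using x x' y' by blast
    qed
  qed (use assms in auto)
qed

text \<open>Each element of \<open>B\<close> is exchanged against \<open>a\<close>, until none is left.\<close>

lemma supports_drop: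
  assumes "finite B" "B \<subseteq> A" "supports (insert a F) D" "supports (F \<union> B) D" "a \<notin> B" "a \<in> A"
  shows "supports F D"
  using assms
proof (induction B rule: finite_induct)
  case empty
  then show ?case by simp
next
  case (insert b B)
  have FB: "finite (F \<union> B)" "F \<union> B \<subseteq> A" using insert by (auto simp: supports_def)
  have "supports (F \<union> B) D"
  proof (rule supports_exchange[of _ a b])
    show "supports (insert a (F \<union> B)) D"
      using insert.prems(2) by (rule supports_mono) (use FB insert in auto)
    show "supports (insert b (F \<union> B)) D" using insert.prems(3) by simp
  qed (use FB insert in auto)
  then show ?case using insert by simp
qed

text \<open>The elements of \<open>E1 - E2\<close> are dropped one at a time: each of them is absent from the
  support \<open>E2\<close>.\<close>

lemma supports_Int:
  assumes E1: "supports E1 D" and E2: "supports E2 D" shows "supports (E1 \<inter> E2) D"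
proof -
  have fin: "finite E1" "E1 \<subseteq> A" "finite E2" "E2 \<subseteq> A" using assms by (auto simp: supports_def)
  have "supports (E1 - B) D" if "finite B" "B \<subseteq> E1 - E2" for B
    using that
  proof (induction B rule: finite_induct)
    case empty
    then show ?case using E1 by simp
  next
    case (insert a B)
    have a: "a \<in> E1" "a \<notin> E2" "a \<notin> B" using insert by auto
    show ?case
    proof (rule supports_drop[of "E2"])
      have "insert a (E1 - insert a B) = E1 - B" using a by auto
      then show "supports (insert a (E1 - insert a B)) D" using insert by simp
      show "supports (E1 - insert a B \<union> E2) D"
        using E2 by (rule supports_mono) (use fin in auto)
    qed (use fin a in auto)
  qed
  from this[of "E1 - E2"] fin have "supports (E1 - (E1 - E2)) D" by auto
  moreover have "E1 - (E1 - E2) = E1 \<inter> E2" by auto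
  ultimately show ?thesis by simp
qed

definition Sym :: "'a set set" where "Sym = {D. \<exists>E. supports E D}"

text \<open>Only meaningful for symmetric sets; for other sets the family is empty.\<close>

definition least_supp :: "'a set \<Rightarrow> 'a set" where
  "least_supp D = \<Inter>{E. supports E D}"

text \<open>A support of least cardinality is contained in every other one, as the intersection of the
  two is again a support.\<close>

lemma least_supp:
  assumes "D \<in> Sym"
  shows "supports (least_supp D) D" "\<And>E. supports E D \<Longrightarrow> least_supp D \<subseteq> E"
proof -
  obtain E where E: "supports E D" "\<And>E'. supports E' D \<Longrightarrow> card E \<le> card E'"
    using assms arg_min_nat_lemma[of "\<lambda>E. supports E D" _ card] unfolding Sym_def by blast
  have min: "E \<subseteq> E'" if "supports E' D" for E'
  proof -
    have fin: "finite E" using E by (simp add: supports_def)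
    have "card E \<le> card (E \<inter> E')" using E supports_Int that by blast
    then have "E \<inter> E' = E" using fin by (simp add: card_seteq)
    then show ?thesis by auto
  qed
  then have "least_supp D = E" using E(1) by (auto simp: least_supp_def)
  then show "supports (least_supp D) D" "\<And>E. supports E D \<Longrightarrow> least_supp D \<subseteq> E"
    using E(1) min by auto
qed

lemma Sym_translate: "D \<in> Sym \<Longrightarrow> g \<in> G \<Longrightarrow> g ` D \<in> Sym"
  using supports_translate by (auto simp: Sym_def)

lemma ginv_image: "g \<in> G \<Longrightarrow> D \<subseteq> A \<Longrightarrow> ginv g ` g ` D = D"
  by (force simp: ginv_left subset_iff image_iff)

lemma Sym_subset: "D \<in> Sym \<Longrightarrow> D \<subseteq> A"
  by (auto simp: Sym_def supports_def)

lemma least_supp_translate: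
  assumes "D \<in> Sym" "g \<in> G" shows "least_supp (g ` D) = g ` least_supp D"
proof
  show "least_supp (g ` D) \<subseteq> g ` least_supp D"
    using assms by (intro least_supp Sym_translate supports_translate)
  have "supports (ginv g ` least_supp (g ` D)) (ginv g ` g ` D)"
    using assms by (intro supports_translate least_supp Sym_translate ginv_G)
  then have "least_supp D \<subseteq> ginv g ` least_supp (g ` D)"
    using assms by (intro least_supp) (simp_all add: ginv_image Sym_subset)
  then have "g ` least_supp D \<subseteq> g ` ginv g ` least_supp (g ` D)" by blast
  also have "\<dots> = least_supp (g ` D)"
  proof -
    have "least_supp (g ` D) \<subseteq> A" using least_supp(1)[OF Sym_translate[OF assms]]
      by (simp add: supports_def)
    then show ?thesis using assms(2) by (force simp: ginv_right subset_iff image_iff)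
  qed
  finally show "g ` least_supp D \<subseteq> least_supp (g ` D)" .
qed


section \<open>Each finite set supports only finitely many sets of atoms\<close>

definition type_over :: "'a set \<Rightarrow> 'a \<Rightarrow> 'a set \<times> ('a list \<times> nat) set" where
  "type_over E x = ({u \<in> E. u \<prec> x},
     {(us, k). distinct us \<and> set us \<subseteq> E \<and> k \<le> length us \<and> ins x us k \<in> R (length us)})"

text \<open>A set supported by \<open>E\<close> is determined by its trace on \<open>E\<close> and by the types over
  \<open>E\<close> that its other elements have. There are finitely many such types: only lists without
  repetition matter, hence only finitely many of the relations.\<close>

lemma finite_supported:
  assumes E: "finite E" "E \<subseteq> A" shows "finite {D. supports E D}"
proof -
  let ?Q = "{us. distinct us \<and> set us \<subseteq> E}"
  let ?Z = "Pow E \<times> Pow (?Q \<times> {..card E})"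
  have Z: "finite ?Z" using E finite_distinct_lists[OF E(1)] by (intro finite_cartesian_product) auto
  have type_over_Z: "type_over E x \<in> ?Z" for x
    using E by (auto simp: type_over_def intro: order_trans[OF _ card_mono] simp flip: distinct_card)
  have type_over_conj: "conj_over E x y" if eq: "type_over E x = type_over E y" and xy: "x \<in> A - E" "y \<in> A - E" for x y
  proof (rule same_type_conjugate[of E x y])
    show "u \<prec> x \<longleftrightarrow> u \<prec> y" if "u \<in> E" for u using eq that by (auto simp: type_over_def)
    show "ins x us k \<in> R (length us) \<longleftrightarrow> ins y us k \<in> R (length us)"
      if us: "distinct us" "set us \<subseteq> E" "k \<le> length us" for us k
    proof -
      have "(us, k) \<in> snd (type_over E x) \<longleftrightarrow> (us, k) \<in> snd (type_over E y)" using eq by simp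
      then show ?thesis using us by (simp add: type_over_def)
    qed
  qed (use E xy in \<open>auto simp: conj_over_def\<close>)
  let ?h = "\<lambda>D. (D \<inter> E, type_over E ` (D - E))"
  have sub: "D \<subseteq> D'" if D: "supports E D" "supports E D'" and eq: "?h D = ?h D'" for D D'
  proof
    fix x assume x: "x \<in> D"
    show "x \<in> D'"
    proof (cases "x \<in> E")
      case True
      then show ?thesis using eq x by blast
    next
      case False
      then have "type_over E x \<in> type_over E ` (D' - E)" using eq x by blast
      then obtain y where y: "y \<in> D'" "y \<notin> E" "type_over E x = type_over E y" by auto
      moreover have "x \<in> A" "y \<in> A" using D x y by (auto simp: supports_def)
      ultimately show ?thesis using supports_conj[OF D(2) type_over_conj[of x y]] False by auto
    qed
  qed
  have "inj_on ?h {D. supports E D}"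
  proof (rule inj_onI)
    fix D D' assume "D \<in> {D. supports E D}" "D' \<in> {D. supports E D}" "?h D = ?h D'"
    then show "D = D'" using sub[of D D'] sub[of D' D] by (metis mem_Collect_eq subset_antisym)
  qed
  moreover have "?h ` {D. supports E D} \<subseteq> Pow E \<times> Pow ?Z" using type_over_Z by blast
  moreover have "finite (Pow E \<times> Pow ?Z)" using E(1) Z by blast
  ultimately show ?thesis by (meson finite_imageD finite_subset)
qed

lemma countable_Sym: "countable Sym"
proof -
  have "Sym = (\<Union>E \<in> {E. finite E \<and> E \<subseteq> A}. {D. supports E D})"
    by (auto simp: Sym_def supports_def)
  moreover have "countable {E. finite E \<and> E \<subseteq> A}"
    using countable_Collect_finite_subset[OF countable_A] by (simp add: conj_commute)
  ultimately show ?thesis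
    using finite_supported by (metis (mono_tags, lifting) countable_UN countable_finite mem_Collect_eq)
qed


section \<open>Injecting the symmetric sets of atoms into the finite sequences\<close>

text \<open>The increasing enumeration of a finite set. It is canonical, hence it commutes with the
  automorphisms.\<close>

definition enum :: "'a set \<Rightarrow> 'a list" where
  "enum E = (THE l. sorted_wrt (\<lambda>x y. x \<prec> y) l \<and> set l = E)"

lemma sorted_unique:
  "\<lbrakk>sorted_wrt (\<lambda>x y. x \<prec> y) l; sorted_wrt (\<lambda>x y. x \<prec> y) l'; set l = set l'\<rbrakk> \<Longrightarrow> l = l'"
proof (induction l arbitrary: l')
  case (Cons a l)
  then obtain b k where l': "l' = b # k" by (cases l') auto
  have "a = b"
  proof (rule ccontr)
    assume "a \<noteq> b"
    then have "a \<in> set k" "b \<in> set l" using Cons.prems(3) l' by auto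
    then show False using Cons.prems(1,2) l' lt_asym by auto
  qed
  moreover have "a \<notin> set l" "b \<notin> set k" using Cons.prems(1,2) l' lt_irrefl by auto
  ultimately have "set l = set k" using Cons.prems(3) l' by auto
  then show ?case using Cons l' \<open>a = b\<close> by simp
qed simp

lemma sorted_exists:
  assumes "finite E" "E \<subseteq> A" shows "\<exists>l. sorted_wrt (\<lambda>x y. x \<prec> y) l \<and> set l = E"
  using assms
proof (induction E rule: finite_induct)
  case (insert x E)
  then obtain l where l: "sorted_wrt (\<lambda>x y. x \<prec> y) l" "set l = E" by auto
  let ?l = "filter (\<lambda>y. y \<prec> x) l @ x # filter (\<lambda>y. x \<prec> y) l"
  have "sorted_wrt (\<lambda>x y. x \<prec> y) ?l"
    using l(1) by (auto simp: sorted_wrt_append sorted_wrt_filter dest: lt_trans)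
  moreover have "set ?l = insert x E"
    using l insert lt_total by auto
  ultimately show ?case by blast
qed simp

lemma enum:
  assumes "finite E" "E \<subseteq> A" shows "sorted_wrt (\<lambda>x y. x \<prec> y) (enum E)" "set (enum E) = E"
proof -
  have "\<exists>!l. sorted_wrt (\<lambda>x y. x \<prec> y) l \<and> set l = E"
    using sorted_exists[OF assms] sorted_unique by auto
  from theI'[OF this] show "sorted_wrt (\<lambda>x y. x \<prec> y) (enum E)" "set (enum E) = E"
    by (simp_all add: enum_def)
qed

lemma enum_translate:
  assumes "finite E" "E \<subseteq> A" "g \<in> G" shows "enum (g ` E) = map g (enum E)"
proof (rule sorted_unique)
  have "finite (g ` E)" "g ` E \<subseteq> A" using assms G_image by auto
  note g = enum[OF this] and e = enum[OF assms(1,2)]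
  show "sorted_wrt (\<lambda>x y. x \<prec> y) (enum (g ` E))" by (rule g)
  show "set (enum (g ` E)) = set (map g (enum E))" using g e by simp
  show "sorted_wrt (\<lambda>x y. x \<prec> y) (map g (enum E))"
    unfolding sorted_wrt_map using e(1)
    by (rule sorted_wrt_mono_rel[rotated]) (use e(2) assms(2,3) in \<open>auto simp: G_lt subset_iff\<close>)
qed

definition orbit :: "'a set \<Rightarrow> 'a set set" where "orbit D = (\<lambda>g. g ` D) ` G"

lemma orbit_refl: "D \<subseteq> A \<Longrightarrow> D \<in> orbit D"
proof -
  assume "D \<subseteq> A"
  then have "restrict (\<lambda>x. x) A ` D = D" by (auto simp: image_iff subset_iff)
  then show ?thesis using G_intro[OF lisomorphism_id] unfolding orbit_def by (metis image_eqI)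
qed

lemma orbit_translate:
  assumes "D \<subseteq> A" "g \<in> G" shows "orbit (g ` D) = orbit D"
proof -
  have sub: "orbit (h ` E) \<subseteq> orbit E" if "E \<subseteq> A" "h \<in> G" for h E
  proof
    fix X assume "X \<in> orbit (h ` E)"
    then obtain k where "k \<in> G" "X = k ` h ` E" by (auto simp: orbit_def)
    moreover from this have "X = restrict (\<lambda>x. k (h x)) A ` E"
      using that(1) by (auto simp: image_iff subset_iff)
    ultimately show "X \<in> orbit E"
      unfolding orbit_def using G_comp[of k h] that(2) by blast
  qed
  have "orbit (ginv g ` g ` D) \<subseteq> orbit (g ` D)"
    using assms by (intro sub G_image ginv_G)
  then show ?thesis using sub[OF assms] assms by (auto simp: ginv_image)
qed

definition orbit_index :: "'a set \<Rightarrow> nat" where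
  "orbit_index D = to_nat_on (orbit ` Sym) (orbit D)"

lemma orbit_index_translate:
  "D \<subseteq> A \<Longrightarrow> g \<in> G \<Longrightarrow> orbit_index (g ` D) = orbit_index D"
  by (simp add: orbit_index_def orbit_translate)

lemma orbit_index_eq:
  assumes "D \<in> Sym" "D' \<in> Sym" "orbit_index D = orbit_index D'"
  obtains g where "g \<in> G" "D' = g ` D"
proof -
  have "orbit D = orbit D'"
    using assms countable_Sym unfolding orbit_index_def
    by (subst (asm) to_nat_on_inj) auto
  then have "D' \<in> orbit D" using orbit_refl Sym_subset assms by blast
  then show ?thesis using that by (auto simp: orbit_def)
qed

text \<open>A symmetric set is determined by its orbit under \<open>G\<close> together with its least support: an
  automorphism that maps the least support to itself preserves its order, so it fixes the support
  pointwise and hence fixes the set. The two points \<open>p\<close> and \<open>q\<close> serve to write the number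
  of the orbit into the sequence.\<close>

definition code_set :: "'a \<Rightarrow> 'a \<Rightarrow> 'a set \<Rightarrow> 'a list" where
  "code_set p q D = replicate (orbit_index D) p @ q # enum (least_supp D)"

lemma code_set_inject:
  assumes "p \<noteq> q" "D \<in> Sym" "D' \<in> Sym" "code_set p q D = code_set p q D'"
  shows "D = D'"
proof -
  have eq: "orbit_index D = orbit_index D'" "enum (least_supp D) = enum (least_supp D')"
    using replicate_separator_inject[OF assms(1) assms(4)[unfolded code_set_def]] by auto
  obtain g where g: "g \<in> G" "D' = g ` D" 
    by (rule orbit_index_eq[OF assms(2,3) eq(1)])
  have fin: "finite (least_supp D)" "least_supp D \<subseteq> A"
    using least_supp(1)[OF assms(2)] by (auto simp: supports_def)
  have "map g (enum (least_supp D)) = enum (least_supp D)"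
    using eq(2) g fin assms(2) by (simp add: least_supp_translate enum_translate)
  then have "g e = e" if "e \<in> least_supp D" for e
    using enum(2)[OF fin] that by (metis map_eq_conv map_ident)
  then have "g ` D = D" using supports_image[OF least_supp(1)[OF assms(2)] g(1)] by blast
  then show ?thesis using g by simp
qed

lemma code_set_translate:
  assumes "D \<in> Sym" "g \<in> G" "g p = p" "g q = q"
  shows "code_set p q (g ` D) = map g (code_set p q D)"
proof -
  have "finite (least_supp D)" "least_supp D \<subseteq> A"
    using least_supp(1)[OF assms(1)] by (auto simp: supports_def)
  then show ?thesis
    using assms by (simp add: code_set_def orbit_index_translate Sym_subset least_supp_translate
        enum_translate map_replicate)
qed

lemma code_set_in_A: "D \<in> Sym \<Longrightarrow> p \<in> A \<Longrightarrow> q \<in> A \<Longrightarrow> set (code_set p q D) \<subseteq> A"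
  using least_supp(1)[of D] enum(2)[of "least_supp D"]
  by (auto simp: code_set_def supports_def)


section \<open>Injecting the sequences without repetition into the symmetric sets\<close>

text \<open>The points that extend \<open>us\<close> to a tuple of the relation of the next arity.\<close>

definition fibre :: "'a list \<Rightarrow> 'a set" where
  "fibre us = {x \<in> A. us @ [x] \<in> R (length us)}"

lemma fibre_iff_ins: "us @ [x] = ins x us (length us)"
  by (simp add: ins_def)

lemma fibre_translate:
  assumes "set us \<subseteq> A" "g \<in> G" shows "fibre (map g us) = g ` fibre us"
proof -
  have *: "g x \<in> fibre (map g us) \<longleftrightarrow> x \<in> fibre us" if "x \<in> A" for x
    using G_R[OF assms(2), of "us @ [x]" "length us"] assms that G_in by (simp add: fibre_def)
  show ?thesis
  proof
    show "g ` fibre us \<subseteq> fibre (map g us)" using * by (auto simp: fibre_def)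
    show "fibre (map g us) \<subseteq> g ` fibre us"
    proof
      fix y assume y: "y \<in> fibre (map g us)"
      then have "y \<in> A" by (simp add: fibre_def)
      then have "y = g (ginv g y)" "ginv g y \<in> A" using assms ginv_right ginv_in by metis+
      then show "y \<in> g ` fibre us" using * y by (metis image_eqI)
    qed
  qed
qed

lemma supports_fibre: assumes "set us \<subseteq> A" shows "supports (set us) (fibre us)"
  unfolding supports_def
proof (intro conjI ballI impI)
  fix g x assume g: "g \<in> G" "\<forall>e \<in> set us. g e = e" and "x \<in> fibre us"
  moreover have "map g us = us" using g by (simp add: map_idI)
  ultimately show "g x \<in> fibre us" using fibre_translate[OF assms g(1)] by auto
qed (use assms in \<open>auto simp: fibre_def\<close>)

text \<open>The fibres of the sequences over a finite set are independent. The new point is taken below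
  all of \<open>U\<close>.\<close>

lemma realise_fibres:
  assumes "finite U" "U \<subseteq> A"
  shows "\<exists>z \<in> A - U. \<forall>us. distinct us \<and> set us \<subseteq> U \<longrightarrow> (z \<in> fibre us \<longleftrightarrow> us \<in> T)"
proof -
  obtain z where z: "z \<in> A" "z \<notin> U" "\<forall>us k. distinct us \<and> set us \<subseteq> U \<and> k \<le> length us \<longrightarrow>
        (ins z us k \<in> R (length us) \<longleftrightarrow> (us, k) \<in> {(us, k). us \<in> T})"
    using realise_type[OF assms, of "{}" "{(us, k). us \<in> T}"] by blast
  have "z \<in> fibre us \<longleftrightarrow> us \<in> T" if "distinct us" "set us \<subseteq> U" for us
    using z(3)[rule_format, of us "length us"] that z(1) by (simp add: fibre_def fibre_iff_ins)
  then show ?thesis using z(1,2) by blast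
qed

lemma fibre_inject:
  assumes "distinct us" "set us \<subseteq> A" "distinct vs" "set vs \<subseteq> A" "fibre us = fibre vs"
  shows "us = vs"
proof -
  have "finite (set us \<union> set vs)" "set us \<union> set vs \<subseteq> A" using assms by auto
  from realise_fibres[OF this, of "{us}"] obtain z where
    z: "\<forall>ws. distinct ws \<and> set ws \<subseteq> set us \<union> set vs \<longrightarrow> (z \<in> fibre ws \<longleftrightarrow> ws \<in> {us})"
    by blast
  have "z \<in> fibre us" using z[rule_format, of us] assms(1) by simp
  then have "z \<in> fibre vs" using assms(5) by simp
  then show ?thesis using z[rule_format, of vs] assms(3) by simp
qed


section \<open>No symmetric bijections\<close>

definition inj_lists :: "'a set \<Rightarrow> 'a list set" where
  "inj_lists E = {us. distinct us \<and> set us \<subseteq> E}"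

text \<open>The cells of the partition of \<open>A - E\<close> that is generated by the fibres of the sequences
  without repetition over \<open>E\<close>.\<close>

definition cell :: "'a set \<Rightarrow> 'a list set \<Rightarrow> 'a set" where
  "cell E T = {x \<in> A - E. \<forall>us \<in> inj_lists E. x \<in> fibre us \<longleftrightarrow> us \<in> T}"

lemma supports_cell:
  assumes E: "finite E" "E \<subseteq> A" shows "supports E (cell E T)"
  unfolding supports_def
proof (intro conjI ballI impI)
  fix g x assume g: "g \<in> G" "\<forall>e \<in> E. g e = e" and x: "x \<in> cell E T"
  have xA: "x \<in> A" "x \<notin> E" using x by (auto simp: cell_def)
  have "g x \<notin> E" using G_inj[OF g(1), of "g x" x] g xA E by auto
  moreover have "g x \<in> fibre us \<longleftrightarrow> x \<in> fibre us" if "us \<in> inj_lists E" for us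
  proof (rule supports_conj[symmetric])
    show "supports E (fibre us)"
      using that E supports_fibre[of us] by (auto simp: inj_lists_def intro: supports_mono)
  qed (use g xA in \<open>auto simp: conj_over_def\<close>)
  ultimately show "g x \<in> cell E T" using x G_in[OF g(1) xA(1)] by (auto simp: cell_def)
qed (use E in \<open>auto simp: cell_def\<close>)

lemma cell_inject:
  assumes "finite E" "E \<subseteq> A" "T \<subseteq> inj_lists E" "T' \<subseteq> inj_lists E" "cell E T = cell E T'"
  shows "T = T'"
proof -
  obtain z where z: "z \<in> A - E" "\<forall>us. distinct us \<and> set us \<subseteq> E \<longrightarrow> (z \<in> fibre us \<longleftrightarrow> us \<in> T)"
    using realise_fibres[OF assms(1,2), of T] by blast
  then have "z \<in> cell E T" by (auto simp: cell_def inj_lists_def)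
  then have "z \<in> cell E T'" using assms(5) by simp
  then show ?thesis using z assms(3,4) by (auto simp: cell_def inj_lists_def)
qed

text \<open>If \<open>f\<close> commutes with the automorphisms fixing \<open>E\<close>, then the sets supported by
  \<open>E\<close> can only be values of lists over \<open>E\<close>. But with every set \<open>T\<close> of lists without
  repetition over \<open>E\<close> there is a cell supported by \<open>E\<close>, so that Cantor's diagonal
  argument applies.\<close>

lemma no_bijection_inj_lists:
  assumes E: "finite E" "E \<subseteq> A"
    and surj: "\<And>D. D \<in> Sym \<Longrightarrow> \<exists>us \<in> inj_lists A. f us = D"
    and inj: "\<And>us vs. us \<in> inj_lists A \<Longrightarrow> vs \<in> inj_lists A \<Longrightarrow> f us = f vs \<Longrightarrow> us = vs"
    and equi: "\<And>us g. us \<in> inj_lists A \<Longrightarrow> g \<in> G \<Longrightarrow> \<forall>e \<in> E. g e = e \<Longrightarrow> f (map g us) = g ` f us"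
  shows False
proof -
  have pre: "\<exists>us \<in> inj_lists E. f us = cell E T" for T
  proof -
    have supp: "supports E (cell E T)" using E by (rule supports_cell)
    then obtain us where us: "us \<in> inj_lists A" "f us = cell E T"
      using surj by (auto simp: Sym_def)
    have "x \<in> E" if x: "x \<in> set us" for x
    proof (rule ccontr)
      assume "x \<notin> E"
      moreover have "x \<in> A" using x us by (auto simp: inj_lists_def)
      ultimately obtain g where g: "g \<in> G" "\<forall>e \<in> E. g e = e" "g x \<noteq> x"
        using escape[OF E, of "{x}" x] unfolding conj_over_def
        by (metis empty_subsetI finite.emptyI finite.insertI insertI1 insert_subset)
      have "f (map g us) = f us" using equi[OF us(1) g(1,2)] supports_image[OF supp g(1)] g us by simp
      moreover have "map g us \<in> inj_lists A"
        using us g by (auto simp: inj_lists_def distinct_map inj_on_def G_inj G_in subset_iff)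
      ultimately have "map g us = us" using inj us by blast
      then show False using g(3) x by (metis map_eq_conv map_ident)
    qed
    then show ?thesis using us by (auto simp: inj_lists_def)
  qed
  define T where "T = {us \<in> inj_lists E. \<exists>T \<subseteq> inj_lists E. f us = cell E T \<and> us \<notin> T}"
  obtain us where us: "us \<in> inj_lists E" "f us = cell E T" using pre by blast
  have T: "T \<subseteq> inj_lists E" by (auto simp: T_def)
  have "us \<in> T \<longleftrightarrow> us \<notin> T"
  proof
    assume "us \<in> T"
    then obtain T' where "T' \<subseteq> inj_lists E" "f us = cell E T'" "us \<notin> T'" by (auto simp: T_def)
    then show "us \<notin> T" using cell_inject[OF E, of T T'] T us(2) by simp
  next
    assume "us \<notin> T"
    then show "us \<in> T" using T us unfolding T_def by blast
  qed
  then show False by simp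
qed

text \<open>A bijection that commutes with the automorphisms fixing \<open>E\<close> would match the finitely
  many sets supported by \<open>E\<close> with the infinitely many lists over \<open>E\<close>.\<close>

lemma no_bijection_lists:
  assumes E: "finite E" "E \<subseteq> A"
    and surj: "\<And>us. set us \<subseteq> A \<Longrightarrow> \<exists>D \<in> Sym. f D = us"
    and inj: "\<And>D D'. D \<in> Sym \<Longrightarrow> D' \<in> Sym \<Longrightarrow> f D = f D' \<Longrightarrow> D = D'"
    and equi: "\<And>D g. D \<in> Sym \<Longrightarrow> g \<in> G \<Longrightarrow> \<forall>e \<in> E. g e = e \<Longrightarrow> f (g ` D) = map g (f D)"
  shows False
proof -
  obtain p where p: "p \<in> A" using infinite_A by (metis finite.emptyI ex_in_conv)
  have "replicate n p \<in> f ` {D. supports (insert p E) D}" for n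
  proof -
    have "set (replicate n p) \<subseteq> A" using p by (simp add: set_replicate_conv_if)
    then obtain D where D: "D \<in> Sym" "f D = replicate n p" using surj by blast
    have "supports (insert p E) D"
      unfolding supports_def
    proof (intro conjI ballI impI)
      fix g x assume g: "g \<in> G" "\<forall>e \<in> insert p E. g e = e" and x: "x \<in> D"
      have "f (g ` D) = f D" using equi[OF D(1) g(1)] g D by simp
      then have "g ` D = D" using inj D Sym_translate g by blast
      then show "g x \<in> D" using x by blast
    qed (use E p Sym_subset[OF D(1)] in auto)
    then show ?thesis using D(2) by (metis image_eqI mem_Collect_eq)
  qed
  then have "range (\<lambda>n. replicate n p) \<subseteq> f ` {D. supports (insert p E) D}" by blast
  moreover have "finite {D. supports (insert p E) D}" using finite_supported E p by simp
  ultimately have "finite (range (\<lambda>n. replicate n p))" by (meson finite_imageI finite_subset)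
  moreover have "inj (\<lambda>n. replicate n p)" by (auto simp: inj_def)
  ultimately show False using finite_imageD by blast
qed

end


section \<open>Set theory with atoms\<close>

context ZFA begin

text \<open>Classes of objects are HOL sets; those that are the extension of an object are called
  \<open>small\<close>.\<close>

definition elts :: "'a \<Rightarrow> 'a set" where "elts x = {y. y \<epsilon> x}"

definition small :: "'a set \<Rightarrow> bool" where "small C \<longleftrightarrow> (\<exists>x. \<not> atom x \<and> elts x = C)"

definition mk :: "'a set \<Rightarrow> 'a" where "mk C = (THE x. \<not> atom x \<and> elts x = C)"

lemma set_eqI: "\<not> atom x \<Longrightarrow> \<not> atom y \<Longrightarrow> elts x = elts y \<Longrightarrow> x = y"
  using extensionality[of x y] by (auto simp: elts_def)

lemma mk: assumes "small C" shows "\<not> atom (mk C)" "elts (mk C) = C"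
proof -
  have "\<exists>!x. \<not> atom x \<and> elts x = C"
    using assms set_eqI by (auto simp: small_def)
  from theI'[OF this] show "\<not> atom (mk C)" "elts (mk C) = C" by (simp_all add: mk_def)
qed

lemma mk_elts: "\<not> atom x \<Longrightarrow> mk (elts x) = x"
  using mk[of "elts x"] set_eqI by (auto simp: small_def)

lemma mem_mk: "small C \<Longrightarrow> x \<epsilon> mk C \<longleftrightarrow> x \<in> C"
  using mk(2)[of C] by (auto simp: elts_def)

lemma smallI: "\<not> atom y \<Longrightarrow> (\<And>z. z \<epsilon> y \<longleftrightarrow> z \<in> C) \<Longrightarrow> small C"
  unfolding small_def elts_def by blast

lemma mk_inject: "small C \<Longrightarrow> small D \<Longrightarrow> mk C = mk D \<longleftrightarrow> C = D"
  using mk by metis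

lemma elts_atom: "atom a \<Longrightarrow> elts a = {}"
  using atoms_have_no_elements by (auto simp: elts_def)

lemma small_subset_elts: assumes "C \<subseteq> elts x" shows "small C"
proof -
  obtain y where "\<not> atom y" "\<forall>z. z \<epsilon> y \<longleftrightarrow> z \<epsilon> x \<and> z \<in> C"
    using separation[of x "\<lambda>z. z \<in> C"] by auto
  then show ?thesis using assms by (auto simp: small_def elts_def)
qed

lemma small_subset: "small C \<Longrightarrow> D \<subseteq> C \<Longrightarrow> small D"
  using small_subset_elts mk by metis

lemma small_elts [simp]: "small (elts x)"
  by (rule small_subset_elts[OF subset_refl])

lemma small_image: assumes "small C" shows "small (f ` C)"
proof -
  obtain y where "\<not> atom y" "\<forall>z. z \<epsilon> y \<longleftrightarrow> (\<exists>w. w \<epsilon> mk C \<and> z = f w)"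
    using replacement[of "mk C" f] by auto
  then show ?thesis
    by (intro smallI[of y]) (auto simp: mem_mk[OF assms])
qed

lemma small_UN: assumes "small C" shows "small (\<Union>x \<in> C. elts x)"
proof -
  obtain u where "\<not> atom u" "\<forall>z. z \<epsilon> u \<longleftrightarrow> (\<exists>y. y \<epsilon> mk C \<and> z \<epsilon> y)"
    using union[of "mk C"] by auto
  then show ?thesis
    by (intro smallI[of u]) (auto simp: mem_mk[OF assms] elts_def)
qed

lemma small_pair: "small {x, y}"
proof -
  obtain z where "is_upair UNIV z x y" using pairing by auto
  then show ?thesis by (auto simp: small_def elts_def is_upair_def)
qed

lemma small_singleton: "small {x}"
  using small_pair[of x x] by simp

lemma small_empty: "small {}"
  using small_subset[OF small_pair] by blast

lemma small_insert: assumes "small C" shows "small (insert x C)"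
proof -
  have "small (\<Union>y \<in> {mk {x}, mk C}. elts y)" by (intro small_UN small_pair)
  then show ?thesis using mk(2)[OF assms] mk(2)[OF small_singleton] by simp
qed

lemma small_atoms: "small {a. atom a}"
proof -
  obtain u where "is_set_of_atoms UNIV u" using atoms_set by auto
  then show ?thesis by (auto simp: small_def elts_def is_set_of_atoms_def)
qed

lemma not_self_member: "\<not> x \<epsilon> x"
proof
  assume "x \<epsilon> x"
  have x: "w \<epsilon> mk {x} \<longleftrightarrow> w = x" for w
    using mk(2)[OF small_singleton[of x]] by (auto simp: elts_def)
  show False using foundation[of x "mk {x}"] x \<open>x \<epsilon> x\<close> by auto
qed

text \<open>The von Neumann numerals.\<close>

primrec num :: "nat \<Rightarrow> 'a" where
  "num 0 = mk {}"
| "num (Suc n) = mk (insert (num n) (elts (num n)))"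

lemma not_atom_num: "\<not> atom (num n)"
  by (cases n) (simp_all add: mk small_empty small_insert)

lemma elts_num_Suc: "elts (num (Suc n)) = insert (num n) (elts (num n))"
  by (simp add: mk(2)[OF small_insert[OF small_elts]])

lemma elts_num: "elts (num n) = num ` {..<n}"
proof (induction n)
  case 0
  then show ?case by (simp add: mk small_empty)
next
  case (Suc n)
  then show ?case unfolding elts_num_Suc by (simp add: lessThan_Suc)
qed

lemma num_inject: "num m = num n \<longleftrightarrow> m = n"
proof -
  have "num m \<noteq> num n" if "m < n" for m n
  proof
    assume "num m = num n"
    moreover have "num m \<in> elts (num n)" using that by (auto simp: elts_num)
    ultimately show False using not_self_member by (auto simp: elts_def)
  qed
  then show ?thesis by (metis linorder_neqE_nat)
qed

lemma is_succ_num: "is_succ UNIV y (num n) \<longleftrightarrow> y = num (Suc n)"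
proof -
  have "is_succ UNIV y (num n) \<longleftrightarrow> \<not> atom y \<and> elts y = elts (num (Suc n))"
    unfolding elts_num_Suc by (auto simp: is_succ_def elts_def)
  then show ?thesis using set_eqI not_atom_num by blast
qed

text \<open>Every sequence of objects indexed by the type of natural numbers lies in a set, by
  replacement from an inductive set; the indices can be read off, as \<open>num\<close> is injective.\<close>

lemma small_range: "small (range (f :: nat \<Rightarrow> 'a))"
proof -
  obtain I where I: "is_inductive UNIV I" using infinity by auto
  have "num n \<epsilon> I" for n
  proof (induction n)
    case 0
    obtain e where "is_empty UNIV e" "e \<epsilon> I" using I by (auto simp: is_inductive_def)
    moreover from this have "e = num 0"
      using set_eqI[of e "num 0"] not_atom_num[of 0] elts_num[of 0]
      by (auto simp: is_empty_def elts_def)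
    ultimately show ?case by simp
  next
    case (Suc n)
    then show ?case using I is_succ_num[of _ n] by (auto simp: is_inductive_def)
  qed
  then have "small (range num)" by (intro small_subset_elts[of _ I]) (auto simp: elts_def)
  then have "small ((\<lambda>w. f (inv_into UNIV num w)) ` range num)" by (rule small_image)
  moreover have "inj num" by (auto simp: inj_def num_inject)
  ultimately show ?thesis by (simp add: image_image)
qed

lemma small_countable: "countable C \<Longrightarrow> small C"
  by (cases "C = {}") (metis small_empty, metis range_from_nat_into small_range)

text \<open>Foundation speaks of sets only. For a class \<open>Q\<close> it is applied to the part of \<open>Q\<close>
  in the transitive closure \<open>T\<close> of an element, which is a set as a union of a sequence of
  sets.\<close>

lemma wf_mem: "wf {(y, x). y \<epsilon> x}"
  unfolding wf_eq_minimal
proof (intro allI impI)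
  fix Q :: "'a set" and x assume x: "x \<in> Q"
  define u where "u = (\<lambda>y. mk (\<Union>z \<in> elts y. elts z))"
  define t where "t = (\<lambda>n. (u ^^ n) (mk {x}))"
  have u: "elts (u y) = (\<Union>z \<in> elts y. elts z)" for y
    by (simp add: u_def mk small_UN)
  define T where "T = (\<Union>n. elts (t n))"
  have "small T" using small_UN[OF small_range[of t]] by (simp add: T_def)
  have "x \<in> elts (t 0)" by (simp add: t_def mk small_singleton)
  then have "x \<in> T" by (auto simp: T_def)
  have closed: "z \<in> T" if z: "z \<epsilon> y" and y: "y \<in> T" for y z
  proof -
    obtain n where "y \<in> elts (t n)" using y by (auto simp: T_def)
    then have "z \<in> elts (t (Suc n))" using z u[of "t n"] by (auto simp: t_def elts_def)
    then show ?thesis by (auto simp: T_def)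
  qed
  have S: "small (T \<inter> Q)" using \<open>small T\<close> by (rule small_subset) auto
  note mem = mem_mk[OF S]
  then obtain z where "z \<epsilon> mk (T \<inter> Q)" "\<not> (\<exists>w. w \<epsilon> z \<and> w \<epsilon> mk (T \<inter> Q))"
    using foundation[of x "mk (T \<inter> Q)"] x \<open>x \<in> T\<close> by auto
  then show "\<exists>z \<in> Q. \<forall>y. (y, z) \<in> {(y, x). y \<epsilon> x} \<longrightarrow> y \<notin> Q"
    using mem closed by blast
qed

lemma mem_induct [case_names step]:
  assumes "\<And>x. (\<And>y. y \<in> elts x \<Longrightarrow> P y) \<Longrightarrow> P x" shows "P x"
  using wf_mem by (induction x rule: wf_induct_rule) (auto intro: assms simp: elts_def)


section \<open>The action of permutations of the atoms on the universe\<close>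

text \<open>The recursion that any automorphism extending \<open>\<pi>\<close> must satisfy. So it gives both
  existence and uniqueness of the extension.\<close>

definition act :: "('a \<Rightarrow> 'a) \<Rightarrow> 'a \<Rightarrow> 'a" where
  "act \<pi> = wfrec {(y, x). y \<epsilon> x} (\<lambda>f x. if atom x then \<pi> x else mk (f ` elts x))"

lemma act_unfold: "act \<pi> x = (if atom x then \<pi> x else mk (act \<pi> ` elts x))"
proof -
  have "cut (act \<pi>) {(y, x). y \<epsilon> x} x ` elts x = act \<pi> ` elts x"
    by (auto simp: cut_def elts_def)
  then show ?thesis
    using def_wfrec[OF act_def[of \<pi>, THEN eq_reflection] wf_mem, of x] by simp
qed

definition perm :: "('a \<Rightarrow> 'a) \<Rightarrow> bool" where
  "perm \<pi> \<longleftrightarrow> bij_betw \<pi> {a. atom a} {a. atom a}"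

lemma perm_atom: "perm \<pi> \<Longrightarrow> atom a \<Longrightarrow> atom (\<pi> a)"
  unfolding perm_def by (metis bij_betwE mem_Collect_eq)

lemma atom_act: "perm \<pi> \<Longrightarrow> atom (act \<pi> x) \<longleftrightarrow> atom x"
  by (subst act_unfold) (auto simp: perm_atom mk small_image)

lemma elts_act: "perm \<pi> \<Longrightarrow> elts (act \<pi> x) = act \<pi> ` elts x"
  by (subst act_unfold) (auto simp: perm_atom mk small_image elts_atom)

lemma act_atom: "atom a \<Longrightarrow> act \<pi> a = \<pi> a"
  by (subst act_unfold) simp

lemma act_cong: "(\<And>a. atom a \<Longrightarrow> \<pi> a = \<sigma> a) \<Longrightarrow> act \<pi> x = act \<sigma> x"
proof (induction x rule: mem_induct)
  case (step x)
  then have "act \<pi> ` elts x = act \<sigma> ` elts x" by (auto simp: image_iff)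
  then show ?case using step(2) by (simp add: act_unfold[of _ x])
qed

lemma act_id: "(\<And>a. atom a \<Longrightarrow> \<pi> a = a) \<Longrightarrow> act \<pi> x = x"
proof (induction x rule: mem_induct)
  case (step x)
  then have "act \<pi> ` elts x = elts x" by auto
  then show ?case using step(2) by (simp add: act_unfold[of _ x] mk_elts)
qed

lemma act_comp: "perm \<sigma> \<Longrightarrow> act \<pi> (act \<sigma> x) = act (\<lambda>a. \<pi> (\<sigma> a)) x"
proof (induction x rule: mem_induct)
  case (step x)
  then have "act \<pi> ` act \<sigma> ` elts x = act (\<lambda>a. \<pi> (\<sigma> a)) ` elts x"
    by (auto simp: image_image)
  then show ?case
    using step(2) by (auto simp: act_unfold[of _ x] act_atom perm_atom)
      (simp add: act_unfold[of _ "mk _"] mk small_image)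
qed

lemma act_inject: assumes "perm \<pi>" shows "act \<pi> x = act \<pi> y \<longleftrightarrow> x = y"
proof -
  have "act (inv_into {a. atom a} \<pi>) (act \<pi> z) = z" for z
    using assms by (simp add: act_comp) (rule act_id, auto simp: perm_def bij_betw_def)
  then show ?thesis by metis
qed

lemma act_automorphism: assumes "perm \<pi>" shows "eps_automorphism (act \<pi>)"
proof -
  have "act \<pi> (act (inv_into {a. atom a} \<pi>) z) = z" for z
  proof -
    have "perm (inv_into {a. atom a} \<pi>)"
      using assms by (simp add: perm_def bij_betw_inv_into)
    then show ?thesis
      using assms by (simp add: act_comp) (rule act_id, auto simp: perm_def bij_betw_inv_into_right)
  qed
  then have "bij (act \<pi>)"
    using act_inject[OF assms] by (auto simp: bij_def inj_def surj_def) metis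
  moreover have "act \<pi> x \<epsilon> act \<pi> y \<longleftrightarrow> x \<epsilon> y" for x y
  proof -
    have "act \<pi> x \<in> elts (act \<pi> y) \<longleftrightarrow> x \<in> elts y"
      unfolding elts_act[OF assms] by (auto simp: act_inject[OF assms])
    then show ?thesis by (simp add: elts_def)
  qed
  ultimately show ?thesis using atom_act[OF assms] by (simp add: eps_automorphism_def)
qed

lemma automorphism_unique:
  assumes \<phi>: "eps_automorphism \<phi>" and \<psi>: "eps_automorphism \<psi>"
    and eq: "\<And>a. atom a \<Longrightarrow> \<phi> a = \<psi> a"
  shows "\<phi> x = \<psi> x"
proof (induction x rule: mem_induct)
  case (step x)
  have im: "elts (\<chi> y) = \<chi> ` elts y" if "eps_automorphism \<chi>" for \<chi> y
  proof
    show "elts (\<chi> y) \<subseteq> \<chi> ` elts y"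
    proof
      fix z assume "z \<in> elts (\<chi> y)"
      moreover have "surj \<chi>" using that by (simp add: eps_automorphism_def bij_is_surj)
      then obtain w where "z = \<chi> w" by (rule surjE)
      ultimately show "z \<in> \<chi> ` elts y" using that by (auto simp: elts_def eps_automorphism_def)
    qed
    show "\<chi> ` elts y \<subseteq> elts (\<chi> y)" using that by (auto simp: elts_def eps_automorphism_def)
  qed
  show ?case
  proof (cases "atom x")
    case False
    then have "\<not> atom (\<phi> x)" "\<not> atom (\<psi> x)" using \<phi> \<psi> by (auto simp: eps_automorphism_def)
    moreover have "elts (\<phi> x) = elts (\<psi> x)" using step by (simp add: im \<phi> \<psi>)
    ultimately show ?thesis by (rule set_eqI)
  qed (rule eq)
qed

lemma lift_eq_act: assumes "perm \<pi>" shows "lift \<pi> = act \<pi>"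
  unfolding lift_def
proof (rule the_equality)
  show "eps_automorphism (act \<pi>) \<and> (\<forall>a. atom a \<longrightarrow> act \<pi> a = \<pi> a)"
    using act_automorphism[OF assms] act_atom by simp
  show "\<phi> = act \<pi>" if "eps_automorphism \<phi> \<and> (\<forall>a. atom a \<longrightarrow> \<phi> a = \<pi> a)" for \<phi>
  proof (rule HOL.ext)
    show "\<phi> x = act \<pi> x" for x
      by (rule automorphism_unique) (use that act_automorphism[OF assms] act_atom in simp_all)
  qed
qed

lemma lift_mk: "perm \<pi> \<Longrightarrow> small C \<Longrightarrow> lift \<pi> (mk C) = mk (lift \<pi> ` C)"
  by (simp add: lift_eq_act) (subst act_unfold, simp add: mk)

end


section \<open>The filter of symmetry groups\<close>

context generic_structure begin

abbreviation symmetry_filter :: "('a \<Rightarrow> 'a) set set" where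
  "symmetry_filter \<equiv> generated_normal_filter (aut_group M)
     {fixgroup (aut_group M) E | E. finite E \<and> E \<subseteq> A}"

lemma group_aut_group: "group (aut_group M)"
proof -
  have "aut_group M = BijGroup A\<lparr>carrier := G\<rparr>" by (simp add: aut_group_def)
  then show ?thesis using subgroup.subgroup_is_group[OF group_aut group_BijGroup] by simp
qed

lemma mult_aut: "g \<in> G \<Longrightarrow> h \<in> G \<Longrightarrow> g \<otimes>\<^bsub>aut_group M\<^esub> h = restrict (\<lambda>x. g (h x)) A"
  by (simp add: aut_group_def BijGroup_def compose_def)

lemma one_aut: "\<one>\<^bsub>aut_group M\<^esub> = restrict (\<lambda>x. x) A"
  by (simp add: aut_group_def BijGroup_def)

lemma inv_aut:
  assumes "g \<in> G" shows "inv\<^bsub>aut_group M\<^esub> g = ginv g"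
proof (rule group.inv_equality[OF group_aut_group])
  show "ginv g \<otimes>\<^bsub>aut_group M\<^esub> g = \<one>\<^bsub>aut_group M\<^esub>"
    using assms by (auto simp: mult_aut one_aut ginv_G ginv_left)
qed (use assms ginv_G in auto)

lemma subgroup_autI:
  assumes "H \<subseteq> G" "restrict (\<lambda>x. x) A \<in> H"
    "\<And>g h. g \<in> H \<Longrightarrow> h \<in> H \<Longrightarrow> restrict (\<lambda>x. g (h x)) A \<in> H" "\<And>g. g \<in> H \<Longrightarrow> ginv g \<in> H"
  shows "subgroup H (aut_group M)"
  using assms by (intro subgroup.intro) (auto simp: mult_aut one_aut inv_aut subset_iff)

text \<open>The right-hand side is a normal filter, because the conjugate of the pointwise stabiliser of
  \<open>E\<close> by \<open>g\<close> is the pointwise stabiliser of \<open>g ` E\<close>. Every other normal filter that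
  contains the pointwise stabilisers is closed under supergroups and so contains it.\<close>

lemma mem_symmetry_filter:
  "H \<in> symmetry_filter \<longleftrightarrow> subgroup H (aut_group M) \<and>
     (\<exists>E. finite E \<and> E \<subseteq> A \<and> fixgroup (aut_group M) E \<subseteq> H)"
proof -
  let ?F = "{H. subgroup H (aut_group M) \<and>
     (\<exists>E. finite E \<and> E \<subseteq> A \<and> fixgroup (aut_group M) E \<subseteq> H)}"
  have fix_sub: "subgroup (fixgroup (aut_group M) E) (aut_group M)" if "E \<subseteq> A" for E
    using that by (intro subgroup_autI)
      (auto simp: fixgroup_def G_comp ginv_G ginv_fix G_intro[OF lisomorphism_id] subset_iff)
  have "normal_filter (aut_group M) ?F"
    unfolding normal_filter_def
  proof (intro conjI ballI allI impI)
    show "G \<in> ?F"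
      using group.subgroup_self[OF group_aut_group] by (auto simp: fixgroup_def)
  next
    fix H K assume "H \<in> ?F" "subgroup K (aut_group M) \<and> H \<subseteq> K"
    then show "K \<in> ?F" by blast
  next
    fix H K assume "H \<in> ?F" "K \<in> ?F"
    then obtain E E' where E: "finite E" "E \<subseteq> A" "fixgroup (aut_group M) E \<subseteq> H"
      "finite E'" "E' \<subseteq> A" "fixgroup (aut_group M) E' \<subseteq> K"
      and sub: "subgroup H (aut_group M)" "subgroup K (aut_group M)" by auto
    have "subgroup (H \<inter> K) (aut_group M)"
      using group.subgroups_Inter_pair[OF group_aut_group sub] .
    moreover have "fixgroup (aut_group M) (E \<union> E') \<subseteq> H \<inter> K"
      using E by (auto simp: fixgroup_def)
    ultimately show "H \<inter> K \<in> ?F" using E by (auto intro!: exI[of _ "E \<union> E'"])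
  next
    fix g H assume g: "g \<in> G" and "H \<in> ?F"
    then obtain E where E: "finite E" "E \<subseteq> A" "fixgroup (aut_group M) E \<subseteq> H"
      and sub: "subgroup H (aut_group M)" by auto
    let ?K = "(g <#\<^bsub>aut_group M\<^esub> H) #>\<^bsub>aut_group M\<^esub> inv\<^bsub>aut_group M\<^esub> g"
    have HG: "H \<subseteq> G" using sub by (rule subgroup.subset)
    have "fixgroup (aut_group M) (g ` E) \<subseteq> ?K"
    proof
      fix k assume "k \<in> fixgroup (aut_group M) (g ` E)"
      then have k: "k \<in> G" "\<And>e. e \<in> E \<Longrightarrow> k (g e) = g e" by (auto simp: fixgroup_def)
      define h where "h = restrict (\<lambda>x. ginv g (restrict (\<lambda>x. k (g x)) A x)) A"
      have hG: "h \<in> G" unfolding h_def by (intro G_comp ginv_G g k)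
      moreover have "h e = e" if "e \<in> E" for e
        using that E k g by (auto simp: h_def ginv_left subset_iff)
      ultimately have "h \<in> H" using E by (auto simp: fixgroup_def)
      have "k x = undefined" if "x \<notin> A" for x
        using that k(1) by (auto simp: G_iff Bij_def extensional_def)
      then have "k = g \<otimes>\<^bsub>aut_group M\<^esub> h \<otimes>\<^bsub>aut_group M\<^esub> inv\<^bsub>aut_group M\<^esub> g"
      proof -
        have gh: "g \<otimes>\<^bsub>aut_group M\<^esub> h = restrict (\<lambda>x. k (g x)) A"
          using g hG k(1) by (auto simp: mult_aut h_def ginv_right G_in fun_eq_iff)
        then show ?thesis
          unfolding inv_aut[OF g] gh mult_aut[OF G_comp[OF k(1) g] ginv_G[OF g]]
          using \<open>\<And>x. x \<notin> A \<Longrightarrow> k x = undefined\<close>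
          by (auto simp: ginv_right[OF g] ginv_in[OF g] fun_eq_iff)
      qed
      then show "k \<in> ?K" using \<open>h \<in> H\<close> by (auto simp: l_coset_def r_coset_def)
    qed
    moreover have "subgroup ?K (aut_group M)"
      using subgroup_conjugate[OF group_aut_group sub g] .
    moreover have "finite (g ` E)" "g ` E \<subseteq> A" using E g G_image by auto
    ultimately show "?K \<in> ?F" by blast
  qed auto
  moreover have "{fixgroup (aut_group M) E | E. finite E \<and> E \<subseteq> A} \<subseteq> ?F"
    using fix_sub by auto
  ultimately have "symmetry_filter \<subseteq> ?F"
    unfolding generated_normal_filter_def by (intro Inter_lower) blast
  moreover have "?F \<subseteq> symmetry_filter"
  proof
    fix H assume "H \<in> ?F"
    then obtain E where E: "finite E" "E \<subseteq> A" "fixgroup (aut_group M) E \<subseteq> H"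
      and sub: "subgroup H (aut_group M)" by auto
    show "H \<in> symmetry_filter"
      unfolding generated_normal_filter_def
    proof (intro InterI, clarify)
      fix F assume "normal_filter (aut_group M) F"
        "{fixgroup (aut_group M) E | E. finite E \<and> E \<subseteq> A} \<subseteq> F"
      moreover from this have "fixgroup (aut_group M) E \<in> F" using E by blast
      ultimately show "H \<in> F" using E sub unfolding normal_filter_def by blast
    qed
  qed
  ultimately show ?thesis by blast
qed

end


section \<open>The permutation model\<close>

locale permutation_model_V_c = ZFA mem atom + generic_structure M
  for mem :: "'a \<Rightarrow> 'a \<Rightarrow> bool"  (infix "\<epsilon>" 50) and atom :: "'a \<Rightarrow> bool" and M :: "'a lstruct" +
  assumes univ_atoms: "univ M = {a. atom a}"
begin

abbreviation V :: "'a set" where "V \<equiv> V_c M"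

lemma perm_G: "g \<in> G \<Longrightarrow> perm g"
  using G_bij by (simp add: perm_def univ_atoms)

lemma lift_G: "g \<in> G \<Longrightarrow> lift g = act g"
  by (simp add: lift_eq_act perm_G)

lemma lift_atom [simp]: "g \<in> G \<Longrightarrow> a \<in> A \<Longrightarrow> lift g a = g a"
  by (simp add: lift_G act_atom univ_atoms)

lemma atom_lift [simp]: "g \<in> G \<Longrightarrow> atom (lift g x) \<longleftrightarrow> atom x"
  by (simp add: lift_G atom_act perm_G)

lemma elts_lift: "g \<in> G \<Longrightarrow> elts (lift g x) = lift g ` elts x"
  by (simp add: lift_G elts_act perm_G)

lemma lift_mem: "g \<in> G \<Longrightarrow> lift g x \<epsilon> lift g y \<longleftrightarrow> x \<epsilon> y"
  using act_automorphism[OF perm_G] by (simp add: lift_G eps_automorphism_def)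

lemma lift_mk_G: "g \<in> G \<Longrightarrow> small C \<Longrightarrow> lift g (mk C) = mk (lift g ` C)"
  by (simp add: lift_mk perm_G)

lemma lift_comp:
  assumes "g \<in> G" "h \<in> G" shows "lift g (lift h x) = lift (restrict (\<lambda>x. g (h x)) A) x"
proof -
  have "act g (act h x) = act (\<lambda>a. g (h a)) x" using assms by (intro act_comp perm_G)
  also have "\<dots> = act (restrict (\<lambda>x. g (h x)) A) x" by (rule act_cong) (simp add: univ_atoms)
  finally show ?thesis using assms G_comp by (simp add: lift_G)
qed

lemma lift_id: "g \<in> G \<Longrightarrow> (\<And>a. a \<in> A \<Longrightarrow> g a = a) \<Longrightarrow> lift g x = x"
  by (simp add: lift_G univ_atoms act_id)

lemma lift_ginv: assumes "g \<in> G" shows "lift (ginv g) (lift g x) = x"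
  using assms by (simp add: lift_comp ginv_G) (rule lift_id, auto intro: G_comp ginv_G simp: ginv_left)

lemma lift_ginv': assumes "g \<in> G" shows "lift g (lift (ginv g) x) = x"
  using assms by (simp add: lift_comp ginv_G) (rule lift_id, auto intro: G_comp ginv_G simp: ginv_right)

text \<open>The notion of support for arbitrary objects; for sets of atoms it agrees with
  \<open>supports\<close>.\<close>

definition supp_obj :: "'a set \<Rightarrow> 'a \<Rightarrow> bool" where
  "supp_obj E x \<longleftrightarrow> finite E \<and> E \<subseteq> A \<and> (\<forall>g \<in> G. (\<forall>e \<in> E. g e = e) \<longrightarrow> lift g x = x)"

lemma symmetric_iff: "symmetric (aut_group M) symmetry_filter x \<longleftrightarrow> (\<exists>E. supp_obj E x)"
proof -
  have "subgroup {g \<in> G. lift g x = x} (aut_group M)"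
  proof (rule subgroup_autI)
    show "restrict (\<lambda>x. x) A \<in> {g \<in> G. lift g x = x}"
      using G_intro[OF lisomorphism_id] by (auto intro: lift_id)
    show "ginv g \<in> {g \<in> G. lift g x = x}" if "g \<in> {g \<in> G. lift g x = x}" for g
      using that lift_ginv[of g x] ginv_G by auto
    show "restrict (\<lambda>x. g (h x)) A \<in> {g \<in> G. lift g x = x}"
      if "g \<in> {g \<in> G. lift g x = x}" "h \<in> {g \<in> G. lift g x = x}" for g h
      using that lift_comp[of g h x] G_comp by auto
  qed auto
  then show ?thesis
    unfolding symmetric_def mem_symmetry_filter by (auto simp: supp_obj_def fixgroup_def)
qed

lemma V_iff: "x \<in> V \<longleftrightarrow> (\<exists>E. supp_obj E x) \<and> elts x \<subseteq> V"
proof -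
  have V: "x \<in> V \<longleftrightarrow> (\<forall>y. mem\<^sup>*\<^sup>* y x \<longrightarrow> (\<exists>E. supp_obj E y))" for x
    by (simp add: V_c_def permutation_model_def symmetric_iff)
  show ?thesis
  proof
    assume x: "x \<in> V"
    have "y \<in> V" if "y \<epsilon> x" for y
      unfolding V using that x[unfolded V] by (meson rtranclp.rtrancl_into_rtrancl)
    then show "(\<exists>E. supp_obj E x) \<and> elts x \<subseteq> V" using x V by (auto simp: elts_def)
  next
    assume x: "(\<exists>E. supp_obj E x) \<and> elts x \<subseteq> V"
    show "x \<in> V"
      unfolding V
    proof (intro allI impI)
      fix y assume "mem\<^sup>*\<^sup>* y x"
      then show "\<exists>E. supp_obj E y"
        using x V by (cases rule: rtranclp.cases) (auto simp: elts_def)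
    qed
  qed
qed

lemma V_elts: "x \<in> V \<Longrightarrow> elts x \<subseteq> V"
  using V_iff by auto

text \<open>Closure in one direction suffices, since it holds for the inverse automorphisms too.\<close>

lemma supp_obj_mk:
  assumes "small C" "finite E" "E \<subseteq> A"
    and closed: "\<And>g x. g \<in> G \<Longrightarrow> \<forall>e \<in> E. g e = e \<Longrightarrow> x \<in> C \<Longrightarrow> lift g x \<in> C"
  shows "supp_obj E (mk C)"
  unfolding supp_obj_def
proof (intro conjI ballI impI)
  fix g assume g: "g \<in> G" "\<forall>e \<in> E. g e = e"
  have "lift g ` C = C"
  proof
    show "lift g ` C \<subseteq> C" using closed g by blast
    have "\<forall>e \<in> E. ginv g e = e" using g assms by (auto intro: ginv_fix)
    then have "lift (ginv g) x \<in> C" if "x \<in> C" for x using closed ginv_G g that by blast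
    then show "C \<subseteq> lift g ` C" using lift_ginv'[OF g(1)] by (metis image_eqI subsetI)
  qed
  then show "lift g (mk C) = mk C" using g assms by (simp add: lift_mk_G)
qed (use assms in auto)

lemma mk_in_V:
  assumes "small C" "C \<subseteq> V" "finite E" "E \<subseteq> A"
    and closed: "\<And>g x. g \<in> G \<Longrightarrow> \<forall>e \<in> E. g e = e \<Longrightarrow> x \<in> C \<Longrightarrow> lift g x \<in> C"
  shows "mk C \<in> V"
  using supp_obj_mk[OF assms(1,3,4) closed] assms(1,2) mk(2) by (auto simp: V_iff)

lemma atom_in_V: "a \<in> A \<Longrightarrow> a \<in> V"
  using elts_atom[of a] by (subst V_iff) (auto simp: supp_obj_def univ_atoms intro!: exI[of _ "{a}"])

lemma num_lift [simp]: "g \<in> G \<Longrightarrow> lift g (num n) = num n"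
proof (induction n rule: less_induct)
  case (less n)
  then have "elts (lift g (num n)) = elts (num n)"
    by (auto simp: elts_lift elts_num image_image)
  then show ?case using less not_atom_num by (intro set_eqI) auto
qed

lemma num_in_V: "num n \<in> V"
proof (induction n rule: less_induct)
  case (less n)
  then show ?case by (subst V_iff) (auto simp: supp_obj_def elts_num intro!: exI[of _ "{}"])
qed

lemma mk_pair_in_V: assumes "x \<in> V" "y \<in> V" shows "mk {x, y} \<in> V"
proof -
  obtain E F where "supp_obj E x" "supp_obj F y" using assms V_iff by meson
  then show ?thesis
    using assms by (intro mk_in_V[of _ "E \<union> F"] small_pair) (auto simp: supp_obj_def)
qed


section \<open>Functions and sequences inside the model\<close>

definition opair :: "'a \<Rightarrow> 'a \<Rightarrow> 'a" where "opair x y = mk {mk {x}, mk {x, y}}"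

lemma opair_inject: "opair x y = opair x' y' \<longleftrightarrow> x = x' \<and> y = y'"
  unfolding opair_def mk_inject[OF small_pair small_pair] doubleton_eq_iff
    mk_inject[OF small_pair small_singleton] mk_inject[OF small_singleton small_pair]
    mk_inject[OF small_singleton small_singleton]
  by auto

lemma elts_opair: "elts (opair x y) = {mk {x}, mk {x, y}}"
  by (simp add: opair_def mk small_pair)

lemma lift_opair: "g \<in> G \<Longrightarrow> lift g (opair x y) = opair (lift g x) (lift g y)"
  by (simp add: opair_def lift_mk_G small_pair small_singleton)

lemma opair_in_V: "opair x y \<in> V \<longleftrightarrow> x \<in> V \<and> y \<in> V"
proof
  assume "opair x y \<in> V"
  then have "mk {x, y} \<in> V" using V_elts elts_opair by blast
  then show "x \<in> V \<and> y \<in> V" using V_elts[of "mk {x, y}"] mk(2)[OF small_pair] by auto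
next
  assume "x \<in> V \<and> y \<in> V"
  then show "opair x y \<in> V"
    unfolding opair_def using mk_pair_in_V[of x x] by (intro mk_pair_in_V) auto
qed

text \<open>The model is transitive, so the notions relativised to it are evaluated correctly.\<close>

lemma V_elts_eqI:
  assumes "x \<in> V" "C \<subseteq> V" "\<And>w. w \<in> V \<Longrightarrow> w \<epsilon> x \<longleftrightarrow> w \<in> C" shows "elts x = C"
  using assms V_elts[of x] by (auto simp: elts_def)

lemma is_upair_V: assumes "x \<in> V" "y \<in> V" "z \<in> V" shows "is_upair V z x y \<longleftrightarrow> z = mk {x, y}"
proof
  assume z: "is_upair V z x y"
  then have "elts z = {x, y}"
    using assms by (intro V_elts_eqI) (auto simp: is_upair_def)
  then show "z = mk {x, y}" using z mk_elts[of z] by (simp add: is_upair_def)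
qed (auto simp: is_upair_def mk small_pair mem_mk)

lemma is_opair_V: assumes "x \<in> V" "y \<in> V" "p \<in> V" shows "is_opair V p x y \<longleftrightarrow> p = opair x y"
proof -
  have "mk {x} \<in> V" "mk {x, y} \<in> V" using mk_pair_in_V[of x x] mk_pair_in_V assms by auto
  then show ?thesis
    unfolding is_opair_def opair_def using assms by (auto simp: is_upair_V)
qed

lemma maps_to_V:
  assumes "x \<in> V" "y \<in> V" shows "maps_to V f x y \<longleftrightarrow> opair x y \<epsilon> f"
  unfolding maps_to_def using assms opair_in_V by (auto simp: is_opair_V)

definition graph :: "('a \<Rightarrow> 'a) \<Rightarrow> 'a \<Rightarrow> 'a" where
  "graph h X = mk ((\<lambda>x. opair x (h x)) ` elts X)"

lemma elts_graph: "elts (graph h X) = (\<lambda>x. opair x (h x)) ` elts X"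
  by (simp add: graph_def mk small_image)

lemma not_atom_graph: "\<not> atom (graph h X)"
  by (simp add: graph_def mk small_image)

lemma opair_mem_graph: "opair x y \<epsilon> graph h X \<longleftrightarrow> x \<in> elts X \<and> y = h x"
proof -
  have "opair x y \<in> elts (graph h X) \<longleftrightarrow> x \<in> elts X \<and> y = h x"
    unfolding elts_graph by (auto simp: opair_inject)
  then show ?thesis by (simp add: elts_def)
qed

lemma is_function_graph:
  assumes "X \<in> V" "Y \<in> V" shows "is_function V (graph h X) X Y \<longleftrightarrow> h ` elts X \<subseteq> elts Y"
proof
  assume f: "is_function V (graph h X) X Y"
  show "h ` elts X \<subseteq> elts Y"
  proof clarify
    fix x assume x: "x \<in> elts X"
    then have xV: "x \<in> V" using V_elts assms by blast
    obtain y where "y \<in> V" "maps_to V (graph h X) x y"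
      using f x xV unfolding is_function_def elts_def by blast
    then have yh: "y \<in> V" "y = h x" "opair x y \<epsilon> graph h X"
      using xV by (auto simp: maps_to_V opair_mem_graph)
    moreover have "opair x y \<in> V" using xV yh opair_in_V by blast
    ultimately obtain x' y' where "x' \<in> V" "y' \<in> V" "y' \<epsilon> Y" "is_opair V (opair x y) x' y'"
      using f unfolding is_function_def by blast
    then show "h x \<in> elts Y"
      using yh \<open>opair x y \<in> V\<close> by (auto simp: is_opair_V opair_inject elts_def)
  qed
next
  assume h: "h ` elts X \<subseteq> elts Y"
  have hV: "x \<in> V \<and> h x \<in> V" if "x \<in> elts X" for x
    using that h assms V_elts[of X] V_elts[of Y] by auto
  show "is_function V (graph h X) X Y"
    unfolding is_function_def
  proof (intro conjI ballI impI not_atom_graph)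
    fix p assume "p \<in> V" "p \<epsilon> graph h X"
    then obtain x where x: "x \<in> elts X" "p = opair x (h x)"
      using elts_graph[of h X] by (auto simp: elts_def)
    then have "is_opair V p x (h x)" using hV \<open>p \<in> V\<close> by (simp add: is_opair_V)
    then show "\<exists>x\<in>V. \<exists>y\<in>V. x \<epsilon> X \<and> y \<epsilon> Y \<and> is_opair V p x y"
      using x(1) hV[OF x(1)] h by (auto simp: elts_def)
  next
    fix x assume "x \<in> V" "x \<epsilon> X"
    then show "\<exists>!y. y \<in> V \<and> maps_to V (graph h X) x y"
      using hV[of x] by (intro ex1I[of _ "h x"]) (auto simp: maps_to_V opair_mem_graph elts_def)
  qed
qed

lemma is_function_V:
  assumes "f \<in> V" "X \<in> V" "Y \<in> V" and f: "is_function V f X Y"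
  shows "\<exists>h. f = graph h X"
proof -
  define h where "h x = (THE y. y \<in> V \<and> opair x y \<epsilon> f)" for x
  have h: "y = h x" if "x \<in> elts X" "y \<in> V" "opair x y \<epsilon> f" for x y
  proof -
    have x: "x \<in> V" "x \<epsilon> X" using that assms V_elts[of X] by (auto simp: elts_def)
    then have "\<exists>!y. y \<in> V \<and> maps_to V f x y" using f by (simp add: is_function_def)
    then have "\<exists>!y. y \<in> V \<and> opair x y \<epsilon> f" using x by (simp add: maps_to_V cong: conj_cong)
    then show ?thesis unfolding h_def using that by (metis (mono_tags, lifting) the_equality)
  qed
  have "elts f = elts (graph h X)"
  proof
    show "elts f \<subseteq> elts (graph h X)"
    proof
      fix p assume p: "p \<in> elts f"
      then have pV: "p \<in> V" "p \<epsilon> f" using assms V_elts[of f] by (auto simp: elts_def)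
      then obtain x y where xy: "x \<in> V" "y \<in> V" "x \<in> elts X" "is_opair V p x y"
        using f unfolding is_function_def elts_def by blast
      then have "p = opair x y" using pV by (simp add: is_opair_V)
      then show "p \<in> elts (graph h X)" using h[of x y] xy pV by (auto simp: elts_graph)
    qed
    show "elts (graph h X) \<subseteq> elts f"
    proof
      fix p assume "p \<in> elts (graph h X)"
      then obtain x where x: "x \<in> elts X" "p = opair x (h x)" by (auto simp: elts_graph)
      then have xV: "x \<in> V" using assms V_elts by blast
      then obtain y where "y \<in> V" "opair x y \<epsilon> f"
        using f x unfolding is_function_def elts_def by (metis maps_to_V mem_Collect_eq)
      then show "p \<in> elts f" using h[of x y] x by (simp add: elts_def)
    qed
  qed
  then have "f = graph h X" using f not_atom_graph by (intro set_eqI) (auto simp: is_function_def)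
  then show ?thesis by blast
qed

lemma is_injection_graph:
  assumes "X \<in> V" "Y \<in> V"
  shows "is_injection V (graph h X) X Y \<longleftrightarrow> h ` elts X \<subseteq> elts Y \<and> inj_on h (elts X)"
proof (cases "h ` elts X \<subseteq> elts Y")
  case True
  have hV: "x \<in> V \<and> h x \<in> V" if "x \<in> elts X" for x
    using that True assms V_elts[of X] V_elts[of Y] by auto
  then have "(\<forall>x \<in> V. \<forall>x' \<in> V. \<forall>y \<in> V.
        maps_to V (graph h X) x y \<and> maps_to V (graph h X) x' y \<longrightarrow> x = x') \<longleftrightarrow> inj_on h (elts X)"
    by (auto simp: maps_to_V opair_mem_graph inj_on_def)
  then show ?thesis using True assms by (simp add: is_injection_def is_function_graph)
qed (use assms in \<open>simp add: is_injection_def is_function_graph\<close>)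

lemma is_bijection_graph:
  assumes "X \<in> V" "Y \<in> V"
  shows "is_bijection V (graph h X) X Y \<longleftrightarrow> bij_betw h (elts X) (elts Y)"
proof (cases "h ` elts X \<subseteq> elts Y")
  case True
  have hV: "x \<in> V \<and> h x \<in> V" if "x \<in> elts X" for x
    using that True assms V_elts[of X] V_elts[of Y] by auto
  have "(\<forall>y \<in> V. y \<epsilon> Y \<longrightarrow> (\<exists>x \<in> V. maps_to V (graph h X) x y)) \<longleftrightarrow> elts Y \<subseteq> h ` elts X"
  proof
    assume *: "\<forall>y \<in> V. y \<epsilon> Y \<longrightarrow> (\<exists>x \<in> V. maps_to V (graph h X) x y)"
    show "elts Y \<subseteq> h ` elts X"
    proof
      fix y assume "y \<in> elts Y"
      moreover from this have "y \<in> V" using assms V_elts by blast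
      ultimately show "y \<in> h ` elts X"
        using * by (auto simp: maps_to_V opair_mem_graph elts_def[of Y])
    qed
  next
    assume "elts Y \<subseteq> h ` elts X"
    then show "\<forall>y \<in> V. y \<epsilon> Y \<longrightarrow> (\<exists>x \<in> V. maps_to V (graph h X) x y)"
      using hV by (fastforce simp: maps_to_V opair_mem_graph elts_def[of Y])
  qed
  then show ?thesis
    using True assms by (auto simp: is_bijection_def is_injection_graph bij_betw_def)
qed (use assms in \<open>auto simp: is_bijection_def is_injection_graph bij_betw_def\<close>)

text \<open>A function between sets of the model lies in the model iff its graph has a finite support
  \<open>E\<close>. That means that the function commutes with the automorphisms fixing \<open>E\<close>.\<close>

lemma card_leI:
  assumes XY: "X \<in> V" "Y \<in> V" and h: "h ` elts X \<subseteq> elts Y" "inj_on h (elts X)"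
    and E: "finite E" "E \<subseteq> A"
    and equi: "\<And>g x. g \<in> G \<Longrightarrow> \<forall>e \<in> E. g e = e \<Longrightarrow> x \<in> elts X \<Longrightarrow>
      lift g x \<in> elts X \<and> h (lift g x) = lift g (h x)"
  shows "card_le V X Y"
proof -
  have "graph h X \<in> V"
    unfolding graph_def
  proof (rule mk_in_V[of _ E])
    show "(\<lambda>x. opair x (h x)) ` elts X \<subseteq> V"
      using h(1) V_elts[OF XY(1)] V_elts[OF XY(2)] by (auto simp: opair_in_V subset_iff)
    show "lift g p \<in> (\<lambda>x. opair x (h x)) ` elts X"
      if "g \<in> G" "\<forall>e \<in> E. g e = e" "p \<in> (\<lambda>x. opair x (h x)) ` elts X" for g p
      using that equi by (auto simp: lift_opair image_iff) metis
  qed (use E in \<open>auto intro: small_image\<close>)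
  moreover have "is_injection V (graph h X) X Y" using XY h by (simp add: is_injection_graph)
  ultimately show ?thesis unfolding card_le_def by blast
qed

lemma card_eqD:
  assumes XY: "X \<in> V" "Y \<in> V" and "card_eq V X Y"
  shows "\<exists>h E. bij_betw h (elts X) (elts Y) \<and> finite E \<and> E \<subseteq> A \<and>
    (\<forall>g \<in> G. (\<forall>e \<in> E. g e = e) \<longrightarrow> (\<forall>x \<in> elts X. h (lift g x) = lift g (h x)))"
proof -
  obtain f where f: "f \<in> V" "is_bijection V f X Y" using assms by (auto simp: card_eq_def)
  then have "is_function V f X Y" by (simp add: is_bijection_def is_injection_def)
  then obtain h where h: "f = graph h X" using is_function_V f XY by blast
  obtain E where E: "supp_obj E f" using f V_iff by blast
  show ?thesis
  proof (intro exI[of _ h] exI[of _ E] conjI ballI impI)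
    show "bij_betw h (elts X) (elts Y)" using f XY h by (simp add: is_bijection_graph)
    show "finite E" "E \<subseteq> A" using E by (auto simp: supp_obj_def)
    fix g x assume g: "g \<in> G" "\<forall>e \<in> E. g e = e" and x: "x \<in> elts X"
    have "opair x (h x) \<epsilon> f" using x h by (simp add: opair_mem_graph)
    then have "lift g (opair x (h x)) \<epsilon> lift g f" using g lift_mem by simp
    then have "opair (lift g x) (lift g (h x)) \<epsilon> graph h X"
      using E g h by (simp add: supp_obj_def lift_opair)
    then show "h (lift g x) = lift g (h x)" by (simp add: opair_mem_graph)
  qed
qed

text \<open>The set of the numerals is fixed by all automorphisms. Hence it is an inductive set of the
  model, and its least one.\<close>

lemma is_natural_V: assumes "n \<in> V" shows "is_natural V n \<longleftrightarrow> n \<in> range num"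
proof
  have succ: "is_succ V (num (Suc k)) (num k)" for k
    using is_succ_num[of "num (Suc k)" k] by (simp add: is_succ_def del: num.simps)
  have empty: "is_empty V (num 0)"
    using not_atom_num[of 0] elts_num[of 0] by (auto simp: is_empty_def elts_def)
  assume nat: "is_natural V n"
  have omega: "mk (range num) \<in> V"
    by (rule mk_in_V[of _ "{}"]) (auto simp: small_range num_in_V)
  have "is_inductive V (mk (range num))"
    unfolding is_inductive_def
  proof (intro conjI ballI impI)
    show "\<exists>e \<in> V. is_empty V e \<and> e \<epsilon> mk (range num)"
      using empty num_in_V[of 0] by (auto simp: mem_mk small_range simp del: num.simps)
    fix x assume "x \<epsilon> mk (range num)"
    then obtain k where "x = num k" by (auto simp: mem_mk small_range)
    then show "\<exists>y \<in> V. is_succ V y x \<and> y \<epsilon> mk (range num)"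
      using succ[of k] num_in_V[of "Suc k"] by (auto simp: mem_mk small_range simp del: num.simps)
  qed
  then have "n \<epsilon> mk (range num)" using nat omega by (simp add: is_natural_def)
  then show "n \<in> range num" by (simp add: mem_mk small_range)
next
  assume "n \<in> range num"
  then obtain k where k: "n = num k" by auto
  have "num k \<epsilon> I" if I: "I \<in> V" "is_inductive V I" for I k
  proof (induction k)
    case 0
    obtain e where e: "e \<in> V" "is_empty V e" "e \<epsilon> I" using I by (auto simp: is_inductive_def)
    then have "elts e = {}" by (intro V_elts_eqI) (auto simp: is_empty_def)
    then have "e = num 0"
      using e not_atom_num[of 0] elts_num[of 0] by (intro set_eqI) (auto simp: is_empty_def)
    then show ?case using e by simp
  next
    case (Suc k)
    then obtain y where y: "y \<in> V" "is_succ V y (num k)" "y \<epsilon> I"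
      using I num_in_V by (auto simp: is_inductive_def)
    have "elts y = elts (num (Suc k))"
      using y num_in_V[of k] V_elts[OF num_in_V[of k]] unfolding elts_num_Suc
      by (intro V_elts_eqI) (auto simp: is_succ_def elts_def)
    then have "y = num (Suc k)"
      using y not_atom_num[of "Suc k"] by (intro set_eqI) (simp_all add: is_succ_def del: num.simps)
    then show ?case using y by simp
  qed
  then show "is_natural V n" using k by (simp add: is_natural_def)
qed

text \<open>Finite sequences in the sense of the set theory, as functions on a numeral, correspond to
  lists.\<close>

definition seq_of :: "'a list \<Rightarrow> 'a" where
  "seq_of us = graph (\<lambda>x. us ! inv_into UNIV num x) (num (length us))"

lemma inv_num [simp]: "inv_into UNIV num (num i) = i"
  by (rule inv_into_f_f) (auto simp: inj_def num_inject)

lemma graph_num: "graph h (num n) = seq_of (map (\<lambda>i. h (num i)) [0..<n])"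
  unfolding seq_of_def graph_def by (rule arg_cong[where f = mk]) (auto simp: elts_num image_iff)

lemma seq_of_inject: assumes "seq_of us = seq_of vs" shows "us = vs"
proof -
  have mem: "opair (num i) x \<epsilon> seq_of us \<longleftrightarrow> i < length us \<and> x = us ! i" for us i x
    unfolding seq_of_def opair_mem_graph by (auto simp: elts_num num_inject)
  have "i < length us \<longleftrightarrow> i < length vs" for i using mem[of i] assms by metis
  then have "length us = length vs" by (metis linorder_neqE_nat less_irrefl)
  moreover have "us ! i = vs ! i" if "i < length us" for i
    using mem[of i "us ! i" us] mem[of i "us ! i" vs] assms that by simp
  ultimately show ?thesis by (rule nth_equalityI)
qed

lemma lift_seq_of:
  assumes "g \<in> G" "set us \<subseteq> A" shows "lift g (seq_of us) = seq_of (map g us)"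
proof -
  have "lift g ` (\<lambda>x. opair x (us ! inv_into UNIV num x)) ` elts (num (length us)) =
      (\<lambda>x. opair x (map g us ! inv_into UNIV num x)) ` elts (num (length (map g us)))"
    using assms by (auto simp: elts_num image_image lift_opair subset_iff intro!: image_cong)
  then show ?thesis using assms by (simp add: seq_of_def graph_def lift_mk_G small_image)
qed

lemma seq_of_in_V: assumes "set us \<subseteq> A" shows "seq_of us \<in> V"
proof -
  have "supp_obj (set us) (seq_of us)"
    using assms by (auto simp: supp_obj_def lift_seq_of map_idI)
  moreover have "elts (seq_of us) \<subseteq> V"
    using assms atom_in_V num_in_V nth_mem
    by (auto simp: seq_of_def elts_graph elts_num opair_in_V subset_iff)
  ultimately show ?thesis using V_iff by blast
qed

definition atoms where "atoms = mk A"

lemma elts_atoms: "elts atoms = A" and not_atom_atoms: "\<not> atom atoms"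
  using mk small_atoms by (simp_all add: atoms_def univ_atoms)

lemma atoms_in_V: "atoms \<in> V"
  unfolding atoms_def by (rule mk_in_V[of _ "{}"])
    (use small_atoms atom_in_V in \<open>auto simp: G_in simp flip: univ_atoms\<close>)

lemma function_num_iff:
  assumes "s \<in> V"
  shows "is_function V s (num n) atoms \<longleftrightarrow> (\<exists>us. s = seq_of us \<and> length us = n \<and> set us \<subseteq> A)"
    "is_injection V s (num n) atoms \<longleftrightarrow>
       (\<exists>us. s = seq_of us \<and> length us = n \<and> set us \<subseteq> A \<and> distinct us)"
proof -
  have graph_ex: "\<exists>h. s = graph h (num n)" if "is_function V s (num n) atoms"
    using is_function_V[OF assms num_in_V atoms_in_V that] .
  have seq: "seq_of us = graph (\<lambda>x. us ! inv_into UNIV num x) (num n)" if "length us = n" for us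
    using that by (simp add: seq_of_def)
  show "is_function V s (num n) atoms \<longleftrightarrow> (\<exists>us. s = seq_of us \<and> length us = n \<and> set us \<subseteq> A)"
  proof
    assume s: "is_function V s (num n) atoms"
    then obtain h where h: "s = graph h (num n)" using graph_ex by blast
    then have "h ` elts (num n) \<subseteq> A"
      using s by (simp add: is_function_graph num_in_V atoms_in_V elts_atoms)
    then show "\<exists>us. s = seq_of us \<and> length us = n \<and> set us \<subseteq> A"
      using h by (intro exI[of _ "map (\<lambda>i. h (num i)) [0..<n]"]) (auto simp: graph_num elts_num)
  next
    assume "\<exists>us. s = seq_of us \<and> length us = n \<and> set us \<subseteq> A"
    then show "is_function V s (num n) atoms"
      using nth_mem
      by (auto simp: seq is_function_graph num_in_V atoms_in_V elts_atoms elts_num subset_iff)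
  qed
  show "is_injection V s (num n) atoms \<longleftrightarrow>
       (\<exists>us. s = seq_of us \<and> length us = n \<and> set us \<subseteq> A \<and> distinct us)"
  proof
    assume s: "is_injection V s (num n) atoms"
    then obtain h where h: "s = graph h (num n)" using graph_ex by (auto simp: is_injection_def)
    then have "h ` elts (num n) \<subseteq> A" "inj_on h (elts (num n))"
      using s by (simp_all add: is_injection_graph num_in_V atoms_in_V elts_atoms)
    then show "\<exists>us. s = seq_of us \<and> length us = n \<and> set us \<subseteq> A \<and> distinct us"
      using h by (intro exI[of _ "map (\<lambda>i. h (num i)) [0..<n]"])
        (auto simp: graph_num elts_num distinct_map inj_on_def num_inject)
  next
    assume "\<exists>us. s = seq_of us \<and> length us = n \<and> set us \<subseteq> A \<and> distinct us"
    then show "is_injection V s (num n) atoms"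
      using nth_mem
      by (auto simp: seq is_injection_graph num_in_V atoms_in_V elts_atoms elts_num inj_on_def
          nth_eq_iff_index_eq subset_iff)
  qed
qed


section \<open>The three sets and their cardinalities\<close>

text \<open>In the model, these are the sets of cardinality \<open>seq\<^sup>1\<^sup>-\<^sup>1(\<mm>)\<close>,
  \<open>seq(\<mm>)\<close> and \<open>2\<^sup>\<mm>\<close>. All three are countable outside of the model, so that
  replacement provides them.\<close>

definition injseqs where "injseqs = mk (seq_of ` inj_lists A)"
definition seqs where "seqs = mk (seq_of ` {us. set us \<subseteq> A})"
definition subsets where "subsets = mk (mk ` Sym)"

lemma small_seqs: "small (seq_of ` {us. set us \<subseteq> A})"
proof (intro small_countable countable_image)
  show "countable {us. set us \<subseteq> A}"
    using countable_lists[OF countable_A] by (simp add: lists_eq_set)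
qed

lemma inj_lists_subset: "inj_lists A \<subseteq> {us. set us \<subseteq> A}"
  by (auto simp: inj_lists_def)

lemma small_injseqs: "small (seq_of ` inj_lists A)"
  by (rule small_subset[OF small_seqs image_mono[OF inj_lists_subset]])

lemma small_subsets: "small (mk ` Sym)"
  using countable_Sym by (intro small_countable countable_image)

lemmas elts_collections =
  mk(2)[OF small_seqs, folded seqs_def] mk(2)[OF small_injseqs, folded injseqs_def]
  mk(2)[OF small_subsets, folded subsets_def]

lemmas not_atom_collections =
  mk(1)[OF small_seqs, folded seqs_def] mk(1)[OF small_injseqs, folded injseqs_def]
  mk(1)[OF small_subsets, folded subsets_def]

lemma small_set_of_atoms: "D \<subseteq> A \<Longrightarrow> small D"
  using small_subset[OF small_atoms] by (simp add: univ_atoms)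

lemma lift_set_of_atoms: assumes "g \<in> G" "D \<subseteq> A" shows "lift g (mk D) = mk (g ` D)"
proof -
  have "lift g ` D = g ` D" using assms by (auto simp: subset_iff intro!: image_cong)
  then show ?thesis using assms by (simp add: lift_mk_G small_set_of_atoms)
qed

lemma supp_obj_set_of_atoms: assumes "D \<subseteq> A" shows "supp_obj E (mk D) \<longleftrightarrow> supports E D"
proof
  assume E: "supp_obj E (mk D)"
  have "g ` D = D" if g: "g \<in> G" "\<forall>e \<in> E. g e = e" for g
  proof -
    have "mk (g ` D) = mk D" using E g assms by (simp add: supp_obj_def lift_set_of_atoms)
    then show ?thesis using g assms by (simp add: mk_inject small_set_of_atoms G_image)
  qed
  then show "supports E D" using E assms by (auto simp: supports_def supp_obj_def)
next
  assume "supports E D"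
  then show "supp_obj E (mk D)"
    using supports_image[of E D] assms by (auto simp: supp_obj_def lift_set_of_atoms supports_def)
qed

text \<open>The subsets of \<open>A\<close> in the model are the symmetric ones.\<close>

lemma mk_Sym_iff: "y \<in> mk ` Sym \<longleftrightarrow> y \<in> V \<and> \<not> atom y \<and> elts y \<subseteq> A"
proof
  assume "y \<in> mk ` Sym"
  then obtain D where D: "y = mk D" "D \<in> Sym" by auto
  then obtain E where "supports E D" by (auto simp: Sym_def)
  moreover have "D \<subseteq> A" using D Sym_subset by blast
  moreover have "small D" using \<open>D \<subseteq> A\<close> by (rule small_set_of_atoms)
  ultimately show "y \<in> V \<and> \<not> atom y \<and> elts y \<subseteq> A"
    using D atom_in_V supp_obj_set_of_atoms by (auto simp: V_iff[of "mk D"] mk)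
next
  assume y: "y \<in> V \<and> \<not> atom y \<and> elts y \<subseteq> A"
  then obtain E where "supp_obj E (mk (elts y))" using V_iff by (auto simp: mk_elts)
  then have "elts y \<in> Sym" using y by (auto simp: supp_obj_set_of_atoms Sym_def)
  then show "y \<in> mk ` Sym" using y mk_elts by (metis image_eqI)
qed

lemma map_in_inj_lists: "us \<in> inj_lists A \<Longrightarrow> g \<in> G \<Longrightarrow> map g us \<in> inj_lists A"
  by (auto simp: inj_lists_def distinct_map inj_on_def G_inj G_in subset_iff)

lemma collections_in_V: "seqs \<in> V" "injseqs \<in> V" "subsets \<in> V"
proof -
  show "seqs \<in> V"
    unfolding seqs_def
  proof (rule mk_in_V[of _ "{}"])
    show "seq_of ` {us. set us \<subseteq> A} \<subseteq> V" using seq_of_in_V by auto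
    show "lift g x \<in> seq_of ` {us. set us \<subseteq> A}"
      if g: "g \<in> G" and x: "x \<in> seq_of ` {us. set us \<subseteq> A}" for g x
    proof -
      obtain us where us: "x = seq_of us" "set us \<subseteq> A" using x by auto
      then have "lift g x = seq_of (map g us)" "set (map g us) \<subseteq> A"
        using g G_image[of g "set us"] by (simp_all add: lift_seq_of)
      then show ?thesis by blast
    qed
  qed (use small_seqs in auto)
  show "injseqs \<in> V"
    unfolding injseqs_def
  proof (rule mk_in_V[of _ "{}"])
    show "seq_of ` inj_lists A \<subseteq> V" using seq_of_in_V by (auto simp: inj_lists_def)
    show "lift g x \<in> seq_of ` inj_lists A" if "g \<in> G" "x \<in> seq_of ` inj_lists A" for g x
      using that map_in_inj_lists inj_lists_subset by (auto simp: lift_seq_of subset_iff)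
  qed (use small_injseqs in auto)
  show "subsets \<in> V"
    unfolding subsets_def
  proof (rule mk_in_V[of _ "{}"])
    show "mk ` Sym \<subseteq> V" using mk_Sym_iff by blast
    show "lift g x \<in> mk ` Sym" if "g \<in> G" "x \<in> mk ` Sym" for g x
      using that Sym_translate Sym_subset by (auto simp: lift_set_of_atoms)
  qed (use small_subsets in auto)
qed

lemma is_seq_set_seqs: "is_seq_set V seqs atoms"
  unfolding is_seq_set_def
proof (intro conjI ballI not_atom_collections)
  fix s assume s: "s \<in> V"
  have "s \<epsilon> seqs \<longleftrightarrow> (\<exists>us. s = seq_of us \<and> set us \<subseteq> A)"
    using elts_collections(1) by (auto simp: elts_def)
  also have "\<dots> \<longleftrightarrow> (\<exists>n. is_function V s (num n) atoms)"
    using function_num_iff(1)[OF s] by blast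
  also have "\<dots> \<longleftrightarrow> (\<exists>n \<in> V. is_natural V n \<and> is_function V s n atoms)"
    using is_natural_V num_in_V by blast
  finally show "s \<epsilon> seqs \<longleftrightarrow> (\<exists>n \<in> V. is_natural V n \<and> is_function V s n atoms)" .
qed

lemma is_injseq_set_injseqs: "is_injseq_set V injseqs atoms"
  unfolding is_injseq_set_def
proof (intro conjI ballI not_atom_collections)
  fix s assume s: "s \<in> V"
  have "s \<epsilon> injseqs \<longleftrightarrow> (\<exists>us. s = seq_of us \<and> set us \<subseteq> A \<and> distinct us)"
    using elts_collections(2) by (auto simp: elts_def inj_lists_def)
  also have "\<dots> \<longleftrightarrow> (\<exists>n. is_injection V s (num n) atoms)"
    using function_num_iff(2)[OF s] by blast
  also have "\<dots> \<longleftrightarrow> (\<exists>n \<in> V. is_natural V n \<and> is_injection V s n atoms)"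
    using is_natural_V num_in_V by blast
  finally show "s \<epsilon> injseqs \<longleftrightarrow> (\<exists>n \<in> V. is_natural V n \<and> is_injection V s n atoms)" .
qed

lemma is_powerset_subsets: "is_powerset V subsets atoms"
  unfolding is_powerset_def
proof (intro conjI ballI not_atom_collections)
  fix y assume y: "y \<in> V"
  have "y \<epsilon> subsets \<longleftrightarrow> \<not> atom y \<and> elts y \<subseteq> A"
    using elts_collections(3) mk_Sym_iff[of y] y by (auto simp: elts_def)
  also have "elts y \<subseteq> A \<longleftrightarrow> (\<forall>z \<in> V. z \<epsilon> y \<longrightarrow> z \<epsilon> atoms)"
    using V_elts[OF y] elts_atoms by (auto simp: elts_def)
  finally show "y \<epsilon> subsets \<longleftrightarrow> \<not> atom y \<and> (\<forall>z \<in> V. z \<epsilon> y \<longrightarrow> z \<epsilon> atoms)" .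
qed

lemma is_set_of_atoms_atoms: "is_set_of_atoms V atoms"
  using not_atom_atoms elts_atoms by (auto simp: is_set_of_atoms_def elts_def univ_atoms)

definition list_of :: "'a \<Rightarrow> 'a list" where "list_of = inv_into UNIV seq_of"

lemma list_of_seq_of [simp]: "list_of (seq_of us) = us"
  unfolding list_of_def by (rule inv_into_f_f) (auto intro: injI seq_of_inject)

lemma elts_mk_Sym: "D \<in> Sym \<Longrightarrow> elts (mk D) = D"
  by (intro mk small_set_of_atoms Sym_subset)

lemma fibre_in_Sym: "us \<in> inj_lists A \<Longrightarrow> fibre us \<in> Sym"
  using supports_fibre by (auto simp: Sym_def inj_lists_def)

lemma injseqs_le_subsets: "card_le V injseqs subsets"
proof (rule card_leI[where h = "\<lambda>s. mk (fibre (list_of s))" and E = "{}"])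
  let ?h = "\<lambda>s. mk (fibre (list_of s))"
  show "?h ` elts injseqs \<subseteq> elts subsets"
    unfolding elts_collections using fibre_in_Sym by auto
  show "inj_on ?h (elts injseqs)"
  proof (rule inj_onI)
    fix s t assume "s \<in> elts injseqs" "t \<in> elts injseqs" and eq: "?h s = ?h t"
    then obtain us vs where st: "s = seq_of us" "us \<in> inj_lists A" "t = seq_of vs" "vs \<in> inj_lists A"
      by (auto simp: elts_collections)
    then have "fibre us = fibre vs" using eq elts_mk_Sym fibre_in_Sym by (metis list_of_seq_of)
    then show "s = t" using st fibre_inject by (auto simp: inj_lists_def)
  qed
  fix g s assume g: "g \<in> G" and "s \<in> elts injseqs"
  then obtain us where s: "s = seq_of us" "us \<in> inj_lists A" by (auto simp: elts_collections)
  then have us: "set us \<subseteq> A" by (simp add: inj_lists_def)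
  have "fibre us \<subseteq> A" by (auto simp: fibre_def)
  then show "lift g s \<in> elts injseqs \<and> ?h (lift g s) = lift g (?h s)"
    using s g us map_in_inj_lists
    by (auto simp: elts_collections lift_seq_of lift_set_of_atoms fibre_translate)
qed (use collections_in_V in auto)

lemma not_injseqs_eq_subsets: "\<not> card_eq V injseqs subsets"
proof
  assume "card_eq V injseqs subsets"
  then obtain h E where h: "bij_betw h (elts injseqs) (elts subsets)" and E: "finite E" "E \<subseteq> A"
    and equi: "\<And>g x. g \<in> G \<Longrightarrow> \<forall>e \<in> E. g e = e \<Longrightarrow> x \<in> elts injseqs \<Longrightarrow>
      h (lift g x) = lift g (h x)"
    using card_eqD[OF collections_in_V(2,3)] by blast
  define f where "f us = elts (h (seq_of us))" for us
  have hf: "h (seq_of us) = mk (f us) \<and> f us \<in> Sym" if "us \<in> inj_lists A" for us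
  proof -
    have "h (seq_of us) \<in> mk ` Sym"
      using h that by (auto simp: bij_betw_def elts_collections)
    then show ?thesis using elts_mk_Sym by (auto simp: f_def)
  qed
  show False
  proof (rule no_bijection_inj_lists[OF E, of f])
    fix D assume D: "D \<in> Sym"
    then have "mk D \<in> h ` elts injseqs" using h by (simp add: bij_betw_def elts_collections)
    then obtain us where "us \<in> inj_lists A" "h (seq_of us) = mk D" by (auto simp: elts_collections)
    then show "\<exists>us \<in> inj_lists A. f us = D"
      using elts_mk_Sym[OF D] by (intro bexI[of _ us]) (simp_all add: f_def)
  next
    fix us vs assume *: "us \<in> inj_lists A" "vs \<in> inj_lists A" "f us = f vs"
    then have "h (seq_of us) = h (seq_of vs)" using hf by simp
    then have "seq_of us = seq_of vs"
      using h * by (auto simp: bij_betw_def elts_collections inj_on_def)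
    then show "us = vs" by (rule seq_of_inject)
  next
    fix us g assume us: "us \<in> inj_lists A" and g: "g \<in> G" "\<forall>e \<in> E. g e = e"
    have "h (lift g (seq_of us)) = lift g (h (seq_of us))"
      using equi g us by (simp add: elts_collections)
    moreover have "set us \<subseteq> A" using us by (simp add: inj_lists_def)
    ultimately have "h (seq_of (map g us)) = mk (g ` f us)"
      using hf[OF us] g by (simp add: lift_seq_of lift_set_of_atoms Sym_subset)
    then show "f (map g us) = g ` f us"
      using elts_mk_Sym[OF Sym_translate[OF conjunct2[OF hf[OF us]] g(1)]]
      by (simp only: f_def[of "map g us"])
  qed
qed

lemma subsets_le_seqs: "card_le V subsets seqs"
proof -
  obtain p where p: "p \<in> A" using infinite_A by (metis finite.emptyI ex_in_conv)
  obtain q where q: "q \<in> A" "p \<noteq> q"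
    using infinite_A p by (metis finite.emptyI finite_insert finite_subset insertI1 subsetI)
  show ?thesis
  proof (rule card_leI[where h = "\<lambda>y. seq_of (code_set p q (elts y))" and E = "{p, q}"])
    let ?h = "\<lambda>y. seq_of (code_set p q (elts y))"
    show "?h ` elts subsets \<subseteq> elts seqs"
      using code_set_in_A p q by (auto simp: elts_collections elts_mk_Sym)
    show "inj_on ?h (elts subsets)"
    proof (rule inj_onI)
      fix x y assume "x \<in> elts subsets" "y \<in> elts subsets" "?h x = ?h y"
      then obtain D D' where "x = mk D" "D \<in> Sym" "y = mk D'" "D' \<in> Sym"
        "code_set p q D = code_set p q D'"
        by (auto simp: elts_collections elts_mk_Sym dest!: seq_of_inject)
      then show "x = y" using code_set_inject[OF q(2), of D D'] by simp
    qed
    fix g y assume g: "g \<in> G" "\<forall>e \<in> {p, q}. g e = e" and "y \<in> elts subsets"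
    then obtain D where D: "y = mk D" "D \<in> Sym" by (auto simp: elts_collections)
    then have "lift g y = mk (g ` D)" "g ` D \<in> Sym"
      using g Sym_subset Sym_translate by (auto simp: lift_set_of_atoms)
    then show "lift g y \<in> elts subsets \<and> ?h (lift g y) = lift g (?h y)"
      using D g p q code_set_in_A
      by (auto simp: elts_collections elts_mk_Sym code_set_translate lift_seq_of)
  qed (use p q collections_in_V in auto)
qed

lemma not_subsets_eq_seqs: "\<not> card_eq V subsets seqs"
proof
  assume "card_eq V subsets seqs"
  then obtain h E where h: "bij_betw h (elts subsets) (elts seqs)" and E: "finite E" "E \<subseteq> A"
    and equi: "\<And>g x. g \<in> G \<Longrightarrow> \<forall>e \<in> E. g e = e \<Longrightarrow> x \<in> elts subsets \<Longrightarrow>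
      h (lift g x) = lift g (h x)"
    using card_eqD[OF collections_in_V(3,1)] by blast
  define f where "f D = list_of (h (mk D))" for D
  have hf: "h (mk D) = seq_of (f D) \<and> set (f D) \<subseteq> A" if "D \<in> Sym" for D
  proof -
    have "h (mk D) \<in> seq_of ` {us. set us \<subseteq> A}"
      using h that by (auto simp: bij_betw_def elts_collections)
    then show ?thesis by (auto simp: f_def)
  qed
  show False
  proof (rule no_bijection_lists[OF E, of f])
    fix us assume "set us \<subseteq> A"
    then have "seq_of us \<in> h ` elts subsets" using h by (simp add: bij_betw_def elts_collections)
    then obtain D where "D \<in> Sym" "h (mk D) = seq_of us" by (auto simp: elts_collections)
    then show "\<exists>D \<in> Sym. f D = us" by (intro bexI[of _ D]) (simp_all add: f_def)
  next
    fix D D' assume *: "D \<in> Sym" "D' \<in> Sym" "f D = f D'"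
    then have "h (mk D) = h (mk D')" using hf by simp
    then have "mk D = mk D'"
      using h * by (auto simp: bij_betw_def elts_collections inj_on_def)
    then show "D = D'" using * elts_mk_Sym by metis
  next
    fix D g assume D: "D \<in> Sym" and g: "g \<in> G" "\<forall>e \<in> E. g e = e"
    have "h (lift g (mk D)) = lift g (h (mk D))"
      using equi g D by (simp add: elts_collections)
    then have "h (mk (g ` D)) = seq_of (map g (f D))"
      using hf[OF D] g D by (simp add: lift_seq_of lift_set_of_atoms Sym_subset)
    then show "f (g ` D) = map g (f D)" by (simp add: f_def)
  qed
qed

end

theorem proposition7p4p5:
  fixes mem :: "'v \<Rightarrow> 'v \<Rightarrow> bool" and atom :: "'v \<Rightarrow> bool"
    and M :: "'v lstruct" and V :: "'v set"
  assumes "ZFA mem atom"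
    and "is_generic M" and "univ M = {a. atom a}"
    and "V = eps_structure.V_c mem atom M"
  shows "\<exists>A \<in> V. \<exists>S1 \<in> V. \<exists>P \<in> V. \<exists>S \<in> V.
           eps_structure.is_set_of_atoms mem atom V A \<and>
           eps_structure.is_injseq_set mem atom V S1 A \<and>
           eps_structure.is_powerset mem atom V P A \<and>
           eps_structure.is_seq_set mem atom V S A \<and>
           eps_structure.card_less mem atom V S1 P \<and>
           eps_structure.card_less mem atom V P S"
proof -
  interpret permutation_model_V_c mem atom M
    using assms(1-3)
    by (intro permutation_model_V_c.intro generic_structure.intro permutation_model_V_c_axioms.intro)
  show ?thesis
    unfolding assms(4)
  proof (intro bexI conjI)
    show "is_set_of_atoms (V_c M) atoms" by (rule is_set_of_atoms_atoms)
    show "is_injseq_set (V_c M) injseqs atoms" by (rule is_injseq_set_injseqs)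
    show "is_powerset (V_c M) subsets atoms" by (rule is_powerset_subsets)
    show "is_seq_set (V_c M) seqs atoms" by (rule is_seq_set_seqs)
    show "card_less (V_c M) injseqs subsets"
      unfolding card_less_def using injseqs_le_subsets not_injseqs_eq_subsets by (rule conjI)
    show "card_less (V_c M) subsets seqs"
      unfolding card_less_def using subsets_le_seqs not_subsets_eq_seqs by (rule conjI)
  qed (rule atoms_in_V collections_in_V)+
qed

end
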